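(* The functor $\mathrm{clp}:\mathbf{StoneMT}\to\mathbf{BA}$, which sends a Stone MT-algebra $M$ to the boolean algebra $\mathrm{clp}(M)$ of its clopen elements and an MT-morphism $f:M\to N$ to its restriction $f|_{\mathrm{clp}(M)}:\mathrm{clp}(M)\to\mathrm{clp}(N)$, is an equivalence of categories, where $\mathbf{StoneMT}$ is the category of Stone MT-algebras and MT-morphisms and $\mathbf{BA}$ is the category of boolean algebras and boolean homomorphisms.
   Context: An MT-algebra is a pair $M=(B,\square)$ where $B$ is a complete boolean algebra and $\square:B\to B$ satisfies $\square 1=1$, $\square(a\wedge b)=\square a\wedge\square b$, $\square a\le a$, $\square a\le\square\square a$. An MT-morphism $f:M\to N$ is a complete boolean homomorphism with $f(\square_M a)\le\square_N f(a)$ for all $a$. Put $\diamond a=\neg\square\neg a$. An element $a$ is open if $a=\square a$, closed if $a=\diamond a$, clopen if both; $\mathrm{O}(M)$ is the set of open elements and $\mathrm{clp}(M)$ the set of clopen elements (a boolean subalgebra of $B$). $M$ is a $T_1$-algebra if every element is a join of closed elements. $M$ is Hausdorff if every element of $M$ is a join of elements of $\mathrm{AC}(M)=\{a\in M\mid a=\bigwedge\{\diamond\square c\mid c\in M,\ a\le\square c\}\}$. $M$ is zero-dimensional if it is a $T_1$-algebra and $a=\bigvee\{b\in\mathrm{clp}(M)\mid b\le a\}$ for every $a\in\mathrm{O}(M)$. $M$ is compact if for each $S\subseteq\mathrm{O}(M)$ with $\bigvee S=1$ there is a finite $T\subseteq S$ with $\bigvee T=1$. A Stone MT-algebra is a compact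 Hausdorff zero-dimensional MT-algebra. *)

theory Defs
  imports "HOL-Algebra.Complete_Lattice" "HOL-Library.Equipollence"
begin

section \<open>Categories, functors and equivalences\<close>

text \<open>Hom-sets need not be disjoint: a morphism does not remember its domain and codomain.
  Composition \<open>Comp C X Y Z g f\<close> (for \<open>f : X \<rightarrow> Y\<close> and \<open>g : Y \<rightarrow> Z\<close>) and the action of a functor
  on morphisms are therefore indexed by the objects involved.\<close>

record ('o, 'm) category_data =
  Obj :: "'o set"
  Hom :: "'o \<Rightarrow> 'o \<Rightarrow> 'm set"
  Comp :: "'o \<Rightarrow> 'o \<Rightarrow> 'o \<Rightarrow> 'm \<Rightarrow> 'm \<Rightarrow> 'm"
  Ident :: "'o \<Rightarrow> 'm"

definition is_category :: "('o, 'm) category_data \<Rightarrow> bool" where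
  "is_category C \<longleftrightarrow>
     (\<forall>X\<in>Obj C. Ident C X \<in> Hom C X X) \<and>
     (\<forall>X\<in>Obj C. \<forall>Y\<in>Obj C. \<forall>Z\<in>Obj C. \<forall>f\<in>Hom C X Y. \<forall>g\<in>Hom C Y Z.
        Comp C X Y Z g f \<in> Hom C X Z) \<and>
     (\<forall>X\<in>Obj C. \<forall>Y\<in>Obj C. \<forall>f\<in>Hom C X Y.
        Comp C X X Y f (Ident C X) = f \<and> Comp C X Y Y (Ident C Y) f = f) \<and>
     (\<forall>W\<in>Obj C. \<forall>X\<in>Obj C. \<forall>Y\<in>Obj C. \<forall>Z\<in>Obj C.
        \<forall>f\<in>Hom C W X. \<forall>g\<in>Hom C X Y. \<forall>h\<in>Hom C Y Z.
          Comp C W Y Z h (Comp C W X Y g f) = Comp C W X Z (Comp C X Y Z h g) f)"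

definition is_iso :: "('o, 'm) category_data \<Rightarrow> 'o \<Rightarrow> 'o \<Rightarrow> 'm \<Rightarrow> bool" where
  "is_iso C X Y f \<longleftrightarrow> f \<in> Hom C X Y \<and>
     (\<exists>g\<in>Hom C Y X. Comp C X Y X g f = Ident C X \<and> Comp C Y X Y f g = Ident C Y)"

record ('o, 'm, 'p, 'n) functor_data =
  omap :: "'o \<Rightarrow> 'p"
  mmap :: "'o \<Rightarrow> 'o \<Rightarrow> 'm \<Rightarrow> 'n"

definition is_functor ::
  "('o, 'm) category_data \<Rightarrow> ('p, 'n) category_data \<Rightarrow> ('o, 'm, 'p, 'n) functor_data \<Rightarrow> bool" where
  "is_functor C D F \<longleftrightarrow>
     (\<forall>X\<in>Obj C. omap F X \<in> Obj D) \<and>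
     (\<forall>X\<in>Obj C. \<forall>Y\<in>Obj C. \<forall>f\<in>Hom C X Y. mmap F X Y f \<in> Hom D (omap F X) (omap F Y)) \<and>
     (\<forall>X\<in>Obj C. mmap F X X (Ident C X) = Ident D (omap F X)) \<and>
     (\<forall>X\<in>Obj C. \<forall>Y\<in>Obj C. \<forall>Z\<in>Obj C. \<forall>f\<in>Hom C X Y. \<forall>g\<in>Hom C Y Z.
        mmap F X Z (Comp C X Y Z g f) =
        Comp D (omap F X) (omap F Y) (omap F Z) (mmap F Y Z g) (mmap F X Y f))"

definition id_functor :: "('o, 'm, 'o, 'm) functor_data" where
  "id_functor = \<lparr>omap = (\<lambda>X. X), mmap = (\<lambda>X Y f. f)\<rparr>"

definition comp_functor ::
  "('p, 'n, 'q, 'k) functor_data \<Rightarrow> ('o, 'm, 'p, 'n) functor_data \<Rightarrow> ('o, 'm, 'q, 'k) functor_data" where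
  "comp_functor G F =
     \<lparr>omap = (\<lambda>X. omap G (omap F X)),
      mmap = (\<lambda>X Y f. mmap G (omap F X) (omap F Y) (mmap F X Y f))\<rparr>"

definition is_nat_iso ::
  "('o, 'm) category_data \<Rightarrow> ('p, 'n) category_data \<Rightarrow>
   ('o, 'm, 'p, 'n) functor_data \<Rightarrow> ('o, 'm, 'p, 'n) functor_data \<Rightarrow> ('o \<Rightarrow> 'n) \<Rightarrow> bool" where
  "is_nat_iso C D F G \<eta> \<longleftrightarrow>
     (\<forall>X\<in>Obj C. is_iso D (omap F X) (omap G X) (\<eta> X)) \<and>
     (\<forall>X\<in>Obj C. \<forall>Y\<in>Obj C. \<forall>f\<in>Hom C X Y.
        Comp D (omap F X) (omap F Y) (omap G Y) (\<eta> Y) (mmap F X Y f) =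
        Comp D (omap F X) (omap G X) (omap G Y) (mmap G X Y f) (\<eta> X))"

definition is_equivalence ::
  "('o, 'm) category_data \<Rightarrow> ('p, 'n) category_data \<Rightarrow> ('o, 'm, 'p, 'n) functor_data \<Rightarrow> bool" where
  "is_equivalence C D F \<longleftrightarrow>
     is_category C \<and> is_category D \<and> is_functor C D F \<and>
     (\<exists>G. is_functor D C G \<and>
        (\<exists>\<eta>. is_nat_iso C C id_functor (comp_functor G F) \<eta>) \<and>
        (\<exists>\<epsilon>. is_nat_iso D D (comp_functor F G) id_functor \<epsilon>))"


section \<open>Boolean algebras\<close>

text \<open>The one-element boolean algebra is allowed.\<close>

locale boolean_lattice = bounded_lattice L for L (structure) +
  assumes meet_join_distrib:
      "\<lbrakk>x \<in> carrier L; y \<in> carrier L; z \<in> carrier L\<rbrakk> \<Longrightarrow> x \<sqinter> (y \<squnion> z) = (x \<sqinter> y) \<squnion> (x \<sqinter> z)"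
    and complement_exists:
      "x \<in> carrier L \<Longrightarrow> \<exists>y\<in>carrier L. x \<sqinter> y = \<bottom> \<and> x \<squnion> y = \<top>"

definition compl :: "('a, 'b) gorder_scheme \<Rightarrow> 'a \<Rightarrow> 'a" where
  "compl L x = (THE y. y \<in> carrier L \<and> x \<sqinter>\<^bsub>L\<^esub> y = \<bottom>\<^bsub>L\<^esub> \<and> x \<squnion>\<^bsub>L\<^esub> y = \<top>\<^bsub>L\<^esub>)"

text \<open>Morphisms are extensional functions, so that equality of morphisms is equality on the carrier.\<close>

definition BA_hom :: "('a, 'c) gorder_scheme \<Rightarrow> ('b, 'd) gorder_scheme \<Rightarrow> ('a \<Rightarrow> 'b) set" where
  "BA_hom A B = {f \<in> carrier A \<rightarrow>\<^sub>E carrier B.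
     join_pres A B f \<and> meet_pres A B f \<and>
     f \<bottom>\<^bsub>A\<^esub> = \<bottom>\<^bsub>B\<^esub> \<and> f \<top>\<^bsub>A\<^esub> = \<top>\<^bsub>B\<^esub> \<and>
     (\<forall>x\<in>carrier A. f (compl A x) = compl B (f x))}"


section \<open>MT-algebras\<close>

record 'a mt = "'a gorder" +
  box :: "'a \<Rightarrow> 'a"

locale mt_algebra = boolean_lattice M + complete_lattice M for M :: "'a mt" (structure) +
  assumes box_closed: "a \<in> carrier M \<Longrightarrow> box M a \<in> carrier M"
    and box_top: "box M \<top> = \<top>"
    and box_meet: "\<lbrakk>a \<in> carrier M; b \<in> carrier M\<rbrakk> \<Longrightarrow> box M (a \<sqinter> b) = box M a \<sqinter> box M b"
    and box_le: "a \<in> carrier M \<Longrightarrow> box M a \<sqsubseteq> a"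
    and box_le_box_box: "a \<in> carrier M \<Longrightarrow> box M a \<sqsubseteq> box M (box M a)"

definition MT_hom :: "'a mt \<Rightarrow> 'b mt \<Rightarrow> ('a \<Rightarrow> 'b) set" where
  "MT_hom M N = {f \<in> BA_hom M N.
     sup_pres M N f \<and> inf_pres M N f \<and>
     (\<forall>a\<in>carrier M. f (box M a) \<sqsubseteq>\<^bsub>N\<^esub> box N (f a))}"

definition dia :: "'a mt \<Rightarrow> 'a \<Rightarrow> 'a" where
  "dia M a = compl M (box M (compl M a))"

definition opens :: "'a mt \<Rightarrow> 'a set" where
  "opens M = {a \<in> carrier M. a = box M a}"

definition closeds :: "'a mt \<Rightarrow> 'a set" where
  "closeds M = {a \<in> carrier M. a = dia M a}"

definition clopens :: "'a mt \<Rightarrow> 'a set" where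
  "clopens M = opens M \<inter> closeds M"

definition T1 :: "'a mt \<Rightarrow> bool" where
  "T1 M \<longleftrightarrow> (\<forall>a\<in>carrier M. \<exists>S\<subseteq>closeds M. a = \<Squnion>\<^bsub>M\<^esub> S)"

definition AC :: "'a mt \<Rightarrow> 'a set" where
  "AC M = {a \<in> carrier M.
     a = \<Sqinter>\<^bsub>M\<^esub> {dia M (box M c) | c. c \<in> carrier M \<and> a \<sqsubseteq>\<^bsub>M\<^esub> box M c}}"

definition hausdorff_mt :: "'a mt \<Rightarrow> bool" where
  "hausdorff_mt M \<longleftrightarrow> (\<forall>a\<in>carrier M. \<exists>S\<subseteq>AC M. a = \<Squnion>\<^bsub>M\<^esub> S)"

definition zero_dim :: "'a mt \<Rightarrow> bool" where
  "zero_dim M \<longleftrightarrow> T1 M \<and> (\<forall>a\<in>opens M. a = \<Squnion>\<^bsub>M\<^esub> {b \<in> clopens M. b \<sqsubseteq>\<^bsub>M\<^esub> a})"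

definition compact_mt :: "'a mt \<Rightarrow> bool" where
  "compact_mt M \<longleftrightarrow>
     (\<forall>S\<subseteq>opens M. \<Squnion>\<^bsub>M\<^esub> S = \<top>\<^bsub>M\<^esub> \<longrightarrow> (\<exists>T\<subseteq>S. finite T \<and> \<Squnion>\<^bsub>M\<^esub> T = \<top>\<^bsub>M\<^esub>))"

definition stone_mt :: "'a mt \<Rightarrow> bool" where
  "stone_mt M \<longleftrightarrow> mt_algebra M \<and> compact_mt M \<and> hausdorff_mt M \<and> zero_dim M"


section \<open>The categories and the functor\<close>

text \<open>In HOL all objects of one category have their carriers in one fixed type \<open>'u\<close>, and a type is
  not closed under power sets. As usual, the categories therefore consist of objects that are small in
  a suitable sense. \<open>small\<close> may be any isomorphism-invariant notion of size for which the double power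
  set of a small set still fits into \<open>'u\<close>. This is the room needed for the Stone MT-algebra of all
  sets of ultrafilters of a small boolean algebra. Two kinds of instances are given by
  \<open>smallness_bounded\<close> (no assumptions: sets of size at most that of an arbitrary type \<open>'k\<close>, with
  \<open>'u = 'k set set\<close>) and \<open>smallness_universe\<close> (a universe closed under power sets).\<close>

definition smallness :: "('u set \<Rightarrow> bool) \<Rightarrow> bool" where
  "smallness small \<longleftrightarrow>
     (\<forall>A B. small A \<and> A \<approx> B \<longrightarrow> small B) \<and>
     (\<forall>A. small A \<longrightarrow> Pow (Pow A) \<lesssim> (UNIV :: 'u set))"

definition BA :: "('u set \<Rightarrow> bool) \<Rightarrow> ('u gorder, 'u \<Rightarrow> 'u) category_data" where
  "BA small =
     \<lparr>Obj = {A. boolean_lattice A \<and> small (carrier A)},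
      Hom = BA_hom,
      Comp = (\<lambda>A B C g f. compose (carrier A) g f),
      Ident = (\<lambda>A. \<lambda>x\<in>carrier A. x)\<rparr>"

text \<open>The size of a Stone MT-algebra is measured by its clopen elements. The carrier is then at most
  two power sets larger (\<open>stone_mt_lepoll\<close>); over a universe this is the same as requiring the carrier
  to be small (\<open>small_clopens_iff\<close>).\<close>

definition StoneMT :: "('u set \<Rightarrow> bool) \<Rightarrow> ('u mt, 'u \<Rightarrow> 'u) category_data" where
  "StoneMT small =
     \<lparr>Obj = {M. stone_mt M \<and> small (clopens M)},
      Hom = MT_hom,
      Comp = (\<lambda>M N K g f. compose (carrier M) g f),
      Ident = (\<lambda>M. \<lambda>x\<in>carrier M. x)\<rparr>"

definition clp_algebra :: "'a mt \<Rightarrow> 'a gorder" where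
  "clp_algebra M = \<lparr>carrier = clopens M, eq = (=), le = le M\<rparr>"

definition clp :: "('u mt, 'u \<Rightarrow> 'u, 'u gorder, 'u \<Rightarrow> 'u) functor_data" where
  "clp = \<lparr>omap = clp_algebra, mmap = (\<lambda>M N f. restrict f (clopens M))\<rparr>"


section \<open>Facts about sizes\<close>

lemma smallness_bounded:
  "smallness (\<lambda>A :: 'k set set set. A \<lesssim> (UNIV :: 'k set))"
proof -
  have "Pow (Pow A) \<lesssim> (UNIV :: 'k set set set)" if A: "A \<lesssim> (UNIV :: 'k set)"
    for A :: "'k set set set"
  proof -
    obtain f :: "'k set set \<Rightarrow> 'k" where "inj_on f A"
      using A by (auto simp: lepoll_def)
    hence "inj_on (image (image f)) (Pow (Pow A))"
      by (metis inj_on_image_Pow)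
    thus ?thesis by (auto simp: lepoll_def)
  qed
  thus ?thesis
    unfolding smallness_def
    by (auto intro: lepoll_trans1[OF eqpoll_sym])
qed

lemma lepoll_PowI: "A \<lesssim> B \<Longrightarrow> Pow A \<lesssim> Pow B"
  unfolding lepoll_def by (metis image_Pow_mono inj_on_image_Pow)

lemma small_Pow_Pow:
  fixes small :: "'u set \<Rightarrow> bool"
  assumes pow: "\<And>A. small A \<Longrightarrow> \<exists>B. small B \<and> Pow A \<lesssim> B" and A: "small A"
  shows "\<exists>B. small B \<and> Pow (Pow A) \<lesssim> B"
  by (meson A lepoll_PowI lepoll_trans pow)

lemma smallness_universe:
  fixes small :: "'u set \<Rightarrow> bool"
  assumes sub: "\<And>A B. small A \<Longrightarrow> B \<lesssim> A \<Longrightarrow> small B"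
    and pow: "\<And>A. small A \<Longrightarrow> \<exists>B. small B \<and> Pow A \<lesssim> B"
  shows "smallness small"
  unfolding smallness_def
proof (intro conjI allI impI)
  show "small B" if "small A \<and> A \<approx> B" for A B
    using that by (meson eqpoll_imp_lepoll eqpoll_sym sub)
next
  fix A assume "small A"
  then obtain B :: "'u set" where "Pow (Pow A) \<lesssim> B"
    using small_Pow_Pow[of small, OF pow] by blast
  thus "Pow (Pow A) \<lesssim> (UNIV :: 'u set)"
    by (rule lepoll_trans) (simp add: subset_imp_lepoll)
qed

context boolean_lattice
begin

lemma complement_unique:
  assumes x: "x \<in> carrier L" and y: "y \<in> carrier L" and z: "z \<in> carrier L"
    and xy: "x \<sqinter> y = \<bottom>" "x \<squnion> y = \<top>" and xz: "x \<sqinter> z = \<bottom>" "x \<squnion> z = \<top>"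
  shows "y = z"
proof -
  have *: "u \<sqsubseteq> v"
    if u: "u \<in> carrier L" and v: "v \<in> carrier L" and "x \<sqinter> u = \<bottom>" and "x \<squnion> v = \<top>" for u v
  proof -
    have "u = u \<sqinter> (x \<squnion> v)"
      using that(4) top_meet[OF u] by (simp add: eq_is_equal meet_comm)
    also have "\<dots> = (u \<sqinter> x) \<squnion> (u \<sqinter> v)"
      using meet_join_distrib u v x by blast
    also have "\<dots> = \<bottom> \<squnion> (u \<sqinter> v)"
      using that by (simp add: meet_comm)
    also have "\<dots> = u \<sqinter> v"
      using bottom_join[of "u \<sqinter> v"] u v by (simp add: eq_is_equal)
    finally have "u = u \<sqinter> v" .
    thus ?thesis
      by (rule iffD2[OF le_iff_join[OF u v]])
  qed
  show ?thesis
    using *[OF y z] *[OF z y] xy xz y z by (simp add: le_antisym)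
qed

lemma compl_eqI:
  "\<lbrakk>x \<in> carrier L; y \<in> carrier L; x \<sqinter> y = \<bottom>; x \<squnion> y = \<top>\<rbrakk> \<Longrightarrow> compl L x = y"
  unfolding compl_def by (rule the_equality) (auto intro: complement_unique)

lemma compl_props:
  assumes "x \<in> carrier L"
  shows "compl L x \<in> carrier L" "x \<sqinter> compl L x = \<bottom>" "x \<squnion> compl L x = \<top>"
  using complement_exists[OF assms] compl_eqI[OF assms] by metis+

lemma compl_compl: "x \<in> carrier L \<Longrightarrow> compl L (compl L x) = x"
  by (rule compl_eqI) (auto simp: compl_props meet_comm join_comm)

end

lemma stone_mt_lepoll:
  assumes "stone_mt M"
  shows "carrier M \<lesssim> Pow (Pow (clopens M))"
proof -
  interpret mt_algebra M using assms by (simp add: stone_mt_def)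
  have zd: "a = \<Squnion>\<^bsub>M\<^esub> {b \<in> clopens M. b \<sqsubseteq>\<^bsub>M\<^esub> a}" if "a \<in> opens M" for a
    using assms that by (auto simp: stone_mt_def zero_dim_def)
  have t1: "\<exists>S\<subseteq>closeds M. a = \<Squnion>\<^bsub>M\<^esub> S" if "a \<in> carrier M" for a
    using assms that by (auto simp: stone_mt_def zero_dim_def T1_def)
  define V where "V c = {b \<in> clopens M. b \<sqsubseteq>\<^bsub>M\<^esub> compl M c}" for c
  define F where "F a = V ` {c \<in> closeds M. c \<sqsubseteq>\<^bsub>M\<^esub> a}" for a
  have closed_carrier: "c \<in> carrier M" if "c \<in> closeds M" for c
    using that by (simp add: closeds_def)
  have compl_open: "compl M c \<in> opens M" if "c \<in> closeds M" for c
  proof -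
    have c: "c \<in> carrier M" "c = compl M (box M (compl M c))"
      using that by (auto simp: closeds_def dia_def)
    hence "compl M c = box M (compl M c)"
      by (metis box_closed compl_compl compl_props(1))
    thus ?thesis using c by (simp add: opens_def compl_props)
  qed
  have V_inj: "c = d" if "c \<in> closeds M" "d \<in> closeds M" "V c = V d" for c d
  proof -
    have "compl M c = compl M d"
      using zd[OF compl_open[OF that(1)]] zd[OF compl_open[OF that(2)]] that(3)
      unfolding V_def by simp
    thus ?thesis
      using that compl_compl closed_carrier by metis
  qed
  have F_le: "a \<sqsubseteq>\<^bsub>M\<^esub> b" if a: "a \<in> carrier M" and b: "b \<in> carrier M" and F: "F a = F b" for a b
  proof -
    obtain S where S: "S \<subseteq> closeds M" "a = \<Squnion>\<^bsub>M\<^esub> S" using t1 a by blast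
    have S': "S \<subseteq> carrier M" using S closed_carrier by blast
    have "c \<sqsubseteq>\<^bsub>M\<^esub> b" if "c \<in> S" for c
    proof -
      have c: "c \<in> closeds M" using S(1) that by (rule subsetD)
      have "c \<sqsubseteq>\<^bsub>M\<^esub> a" unfolding S(2) by (rule sup_upper[OF S' that])
      hence "V c \<in> F a" using c by (simp add: F_def)
      hence "V c \<in> F b" by (simp add: F)
      then obtain d where d: "d \<in> closeds M" "d \<sqsubseteq>\<^bsub>M\<^esub> b" "V c = V d"
        by (auto simp: F_def)
      thus ?thesis using V_inj[OF c d(1,3)] by simp
    qed
    thus ?thesis unfolding S(2) by (intro sup_least[OF S' b])
  qed
  have "inj_on F (carrier M)"
    by (rule inj_onI) (simp add: F_le le_antisym)
  moreover have "F ` carrier M \<subseteq> Pow (Pow (clopens M))"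
    by (auto simp: F_def V_def)
  ultimately show ?thesis by (auto simp: lepoll_def)
qed

lemma small_clopens_iff:
  fixes small :: "'u set \<Rightarrow> bool"
  assumes sub: "\<And>A B. small A \<Longrightarrow> B \<lesssim> A \<Longrightarrow> small B"
    and pow: "\<And>A. small A \<Longrightarrow> \<exists>B. small B \<and> Pow A \<lesssim> B"
    and M: "stone_mt M"
  shows "small (clopens M) \<longleftrightarrow> small (carrier M)"
proof
  assume "small (clopens M)"
  then obtain B where "small B" "Pow (Pow (clopens M)) \<lesssim> B"
    using small_Pow_Pow[of small, OF pow] by blast
  thus "small (carrier M)"
    using stone_mt_lepoll[OF M] sub by (meson lepoll_trans)
next
  assume "small (carrier M)"
  moreover have "clopens M \<lesssim> carrier M"
    by (rule subset_imp_lepoll) (auto simp: clopens_def opens_def)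
  ultimately show "small (clopens M)" by (rule sub)
qed

end

theory Submission
  imports Defs
begin

text \<open>A Stone MT-algebra \<open>M\<close> is atomic: for an ultrafilter \<open>U\<close> of \<open>clp(M)\<close> the meet \<open>\<Sqinter>U\<close> is nonzero by
  compactness, and since closed elements are meets of clopens and every element is a join of closed
  ones, \<open>\<Sqinter>U\<close> is an atom. Hence \<open>M\<close> is the power set of its atoms, which correspond to the
  ultrafilters of \<open>clp(M)\<close>. An MT-morphism is determined by its values on clopens because it preserves
  arbitrary joins and meets; conversely a boolean homomorphism \<open>h : clp(M) \<rightarrow> clp(N)\<close> pulls each atom of
  \<open>N\<close> back to an atom of \<open>M\<close>, and the preimage map of this function extends \<open>h\<close>. So \<open>clp\<close> is full and
  faithful. It is essentially surjective because the power set of the ultrafilter space of a boolean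
  algebra, encoded in the ambient type, is a Stone MT-algebra.\<close>

section \<open>Fully faithful and essentially surjective functors\<close>

text \<open>Order is the primitive notion of the lattices used here; meets, joins and complements
  are derived from it, so even the fact that \<open>clp_algebra M\<close> computes them as
  \<open>M\<close> does has to be proved. Most such identities are checked in representations by
  sets: an order embedding whose image is closed under intersection and complement forces the
  operations. The points are ultrafilters for a boolean algebra, atoms for a Stone MT-algebra and
  elements of \<open>X\<close> for the constructed algebra.

  Compactness works in two directions. In a given \<open>M\<close> it keeps the meet of an
  ultrafilter of clopens away from \<bottom>, which supplies enough atoms. In the constructed
  algebra it makes each clopen set a finite union of basic ones, so that \<open>clp\<close> returns
  the original algebra and no larger one.

  The inequality for \<open>box\<close> is continuity of the map on points. For the extension of
  \<open>h\<close> it comes from zero-dimensionality: \<open>box M a\<close> is a join of clopens,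
  and \<open>h\<close> keeps these clopen.\<close>

lemma is_categoryD:
  assumes "is_category C"
  shows Ident_in_Hom: "X \<in> Obj C \<Longrightarrow> Ident C X \<in> Hom C X X"
    and Comp_in_Hom: "\<lbrakk>f \<in> Hom C X Y; g \<in> Hom C Y Z; X \<in> Obj C; Y \<in> Obj C; Z \<in> Obj C\<rbrakk>
      \<Longrightarrow> Comp C X Y Z g f \<in> Hom C X Z"
    and Comp_Ident_right: "\<lbrakk>f \<in> Hom C X Y; X \<in> Obj C; Y \<in> Obj C\<rbrakk> \<Longrightarrow> Comp C X X Y f (Ident C X) = f"
    and Comp_Ident_left: "\<lbrakk>f \<in> Hom C X Y; X \<in> Obj C; Y \<in> Obj C\<rbrakk> \<Longrightarrow> Comp C X Y Y (Ident C Y) f = f"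
    and Comp_assoc: "\<lbrakk>f \<in> Hom C W X; g \<in> Hom C X Y; h \<in> Hom C Y Z;
        W \<in> Obj C; X \<in> Obj C; Y \<in> Obj C; Z \<in> Obj C\<rbrakk>
      \<Longrightarrow> Comp C W Y Z h (Comp C W X Y g f) = Comp C W X Z (Comp C X Y Z h g) f"
  using assms unfolding is_category_def by simp_all

lemma is_functorD:
  assumes "is_functor C D F"
  shows omap_in_Obj: "X \<in> Obj C \<Longrightarrow> omap F X \<in> Obj D"
    and mmap_in_Hom: "\<lbrakk>f \<in> Hom C X Y; X \<in> Obj C; Y \<in> Obj C\<rbrakk>
      \<Longrightarrow> mmap F X Y f \<in> Hom D (omap F X) (omap F Y)"
    and mmap_Ident: "X \<in> Obj C \<Longrightarrow> mmap F X X (Ident C X) = Ident D (omap F X)"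
    and mmap_Comp: "\<lbrakk>f \<in> Hom C X Y; g \<in> Hom C Y Z; X \<in> Obj C; Y \<in> Obj C; Z \<in> Obj C\<rbrakk>
      \<Longrightarrow> mmap F X Z (Comp C X Y Z g f) =
        Comp D (omap F X) (omap F Y) (omap F Z) (mmap F Y Z g) (mmap F X Y f)"
  using assms unfolding is_functor_def by simp_all

text \<open>Choice fixes for each \<open>A\<close> an object \<open>obj A\<close> and mutually
  inverse \<open>e A\<close>, \<open>e' A\<close>. Bijectivity on hom-sets then does two jobs: it
  lifts morphisms of \<open>D\<close> to \<open>C\<close>, and it lets every equation in
  \<open>C\<close> be checked after applying \<open>F\<close>, where \<open>e\<close> and
  \<open>e'\<close> cancel.\<close>

lemma is_equivalenceI:
  assumes C: "is_category C" and D: "is_category D" and F: "is_functor C D F"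
    and full_faithful: "\<And>X Y. \<lbrakk>X \<in> Obj C; Y \<in> Obj C\<rbrakk>
      \<Longrightarrow> bij_betw (mmap F X Y) (Hom C X Y) (Hom D (omap F X) (omap F Y))"
    and ess_surj: "\<And>A. A \<in> Obj D \<Longrightarrow> \<exists>X\<in>Obj C. \<exists>f. is_iso D (omap F X) A f"
  shows "is_equivalence C D F"
proof -
  \<comment> \<open>\<open>cat(1-5)\<close> are the laws of \<open>C\<close> and
    \<open>cat(6-10)\<close> those of \<open>D\<close>, so \<open>cat(10)\<close> is associativity
    in \<open>D\<close>; \<open>func(4)\<close> is compatibility with composition.\<close>
  note cat = is_categoryD[OF C] is_categoryD[OF D] and func = is_functorD[OF F]
  have "\<forall>A\<in>Obj D. \<exists>X e e'. X \<in> Obj C \<and> e \<in> Hom D (omap F X) A \<and> e' \<in> Hom D A (omap F X) \<and>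
      Comp D (omap F X) A (omap F X) e' e = Ident D (omap F X) \<and>
      Comp D A (omap F X) A e e' = Ident D A"
    using ess_surj unfolding is_iso_def by meson
  then obtain obj e e' where *: "\<forall>A\<in>Obj D. obj A \<in> Obj C \<and>
      e A \<in> Hom D (omap F (obj A)) A \<and> e' A \<in> Hom D A (omap F (obj A)) \<and>
      Comp D (omap F (obj A)) A (omap F (obj A)) (e' A) (e A) = Ident D (omap F (obj A)) \<and>
      Comp D A (omap F (obj A)) A (e A) (e' A) = Ident D A"
    unfolding bchoice_iff by blast
  have obj[simp]: "obj A \<in> Obj C" and [simp]: "omap F (obj A) \<in> Obj D"
    and e[simp]: "e A \<in> Hom D (omap F (obj A)) A" and e'[simp]: "e' A \<in> Hom D A (omap F (obj A))"
    and e'e: "Comp D (omap F (obj A)) A (omap F (obj A)) (e' A) (e A) = Ident D (omap F (obj A))"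
    and ee': "Comp D A (omap F (obj A)) A (e A) (e' A) = Ident D A" if "A \<in> Obj D" for A
    using * that func(1) by auto
  define lift where "lift X Y = inv_into (Hom C X Y) (mmap F X Y)" for X Y
  have lift[simp]: "lift X Y g \<in> Hom C X Y" "mmap F X Y (lift X Y g) = g"
    if "X \<in> Obj C" "Y \<in> Obj C" "g \<in> Hom D (omap F X) (omap F Y)" for X Y g
    using full_faithful[OF that(1,2)] that(3) unfolding lift_def bij_betw_def
    by (simp_all add: inv_into_into f_inv_into_f)
  have faithful: "f = g" if "mmap F X Y f = mmap F X Y g" "f \<in> Hom C X Y" "g \<in> Hom C X Y"
      "X \<in> Obj C" "Y \<in> Obj C" for X Y f g
    using full_faithful[OF that(4,5)] that(1-3) unfolding bij_betw_def inj_on_def by blast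
  \<comment> \<open>The quasi-inverse sends \<open>h\<close> to the lift of its conjugate by the chosen isomorphisms \<open>e\<close>.\<close>
  define conj where "conj A B h =
    Comp D (omap F (obj A)) B (omap F (obj B)) (e' B) (Comp D (omap F (obj A)) A B h (e A))" for A B h
  have conj[simp]: "conj A B h \<in> Hom D (omap F (obj A)) (omap F (obj B))"
    if "A \<in> Obj D" "B \<in> Obj D" "h \<in> Hom D A B" for A B h
    using that unfolding conj_def by (intro cat) simp_all
  \<comment> \<open>Naturality of \<open>e\<close>, which makes it the counit.\<close>
  have e_conj: "Comp D (omap F (obj A)) (omap F (obj B)) B (e B) (conj A B h) =
      Comp D (omap F (obj A)) A B h (e A)"
    if "A \<in> Obj D" "B \<in> Obj D" "h \<in> Hom D A B" for A B h
    using that unfolding conj_def by (simp add: cat ee')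
  \<comment> \<open>Naturality of \<open>e'\<close>; it yields functoriality of \<open>conj\<close>
    and, at the objects \<open>omap F X\<close>, naturality of the unit.\<close>
  have conj_e': "Comp D A (omap F (obj A)) (omap F (obj B)) (conj A B h) (e' A) =
      Comp D A B (omap F (obj B)) (e' B) h"
    if "A \<in> Obj D" "B \<in> Obj D" "h \<in> Hom D A B" for A B h
  proof -
    have "Comp D A (omap F (obj A)) (omap F (obj B)) (conj A B h) (e' A) =
      Comp D A B (omap F (obj B)) (e' B)
        (Comp D A (omap F (obj A)) B (Comp D (omap F (obj A)) A B h (e A)) (e' A))"
      using that unfolding conj_def by (intro cat(10)[symmetric] cat) simp_all
    also have "Comp D A (omap F (obj A)) B (Comp D (omap F (obj A)) A B h (e A)) (e' A) = h"
      using that by (subst cat(10)[symmetric]) (simp_all add: cat ee')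
    finally show ?thesis .
  qed
  have conj_Comp: "conj A E (Comp D A B E k h) =
      Comp D (omap F (obj A)) (omap F (obj B)) (omap F (obj E)) (conj B E k) (conj A B h)"
    if [simp]: "A \<in> Obj D" "B \<in> Obj D" "E \<in> Obj D" "h \<in> Hom D A B" "k \<in> Hom D B E" for A B E h k
  proof -
    have "Comp D (omap F (obj A)) (omap F (obj B)) (omap F (obj E)) (conj B E k) (conj A B h)
      = Comp D (omap F (obj A)) B (omap F (obj E))
          (Comp D B (omap F (obj B)) (omap F (obj E)) (conj B E k) (e' B))
          (Comp D (omap F (obj A)) A B h (e A))"
      unfolding conj_def[of A B] by (intro cat) (simp_all add: cat)
    also have "\<dots> = Comp D (omap F (obj A)) E (omap F (obj E)) (e' E)
          (Comp D (omap F (obj A)) B E k (Comp D (omap F (obj A)) A B h (e A)))"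
      by (subst conj_e', simp, simp, simp, intro cat(10)[symmetric] cat) simp_all
    also have "\<dots> = conj A E (Comp D A B E k h)"
      by (simp add: conj_def cat)
    finally show ?thesis by simp
  qed
  define G where "G = \<lparr>omap = obj, mmap = (\<lambda>A B h. lift (obj A) (obj B) (conj A B h))\<rparr>"
  have "is_functor D C G"
    unfolding is_functor_def
  proof (intro conjI ballI)
    fix A assume [simp]: "A \<in> Obj D"
    show "mmap G A A (Ident D A) = Ident C (omap G A)"
      by (rule faithful[of "obj A" "obj A"]) (simp_all add: G_def cat func conj_def e'e)
  next
    fix A B E h k
    assume [simp]: "A \<in> Obj D" "B \<in> Obj D" "E \<in> Obj D" "h \<in> Hom D A B" "k \<in> Hom D B E"
    show "mmap G A E (Comp D A B E k h) =
        Comp C (omap G A) (omap G B) (omap G E) (mmap G B E k) (mmap G A B h)"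
    proof (rule faithful[of "obj A" "obj E"])
      have "mmap F (obj A) (obj E)
          (Comp C (obj A) (obj B) (obj E) (mmap G B E k) (mmap G A B h)) =
          conj A E (Comp D A B E k h)"
        by (subst func(4)) (simp_all add: G_def conj_Comp)
      thus "mmap F (obj A) (obj E) (mmap G A E (Comp D A B E k h)) = mmap F (obj A) (obj E)
         (Comp C (omap G A) (omap G B) (omap G E) (mmap G B E k) (mmap G A B h))"
        by (simp add: G_def cat)
    qed (simp_all add: G_def cat)
  qed (simp_all add: G_def)
  moreover have "is_nat_iso D D (comp_functor F G) id_functor e"
    unfolding is_nat_iso_def
  proof (intro conjI ballI)
    fix A assume "A \<in> Obj D"
    thus "is_iso D (omap (comp_functor F G) A) (omap id_functor A) (e A)"
      unfolding is_iso_def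
      by (auto simp: comp_functor_def G_def id_functor_def e'e ee' intro!: bexI[of _ "e' A"])
  qed (simp add: comp_functor_def G_def id_functor_def e_conj)
  \<comment> \<open>The unit has to consist of morphisms of \<open>C\<close>, so at \<open>X\<close>
    it is the lift of \<open>e'\<close> at \<open>omap F X\<close>; its inverse is the corresponding
    lift of \<open>e\<close>.\<close>
  moreover have "is_nat_iso C C id_functor (comp_functor G F)
      (\<lambda>X. lift X (obj (omap F X)) (e' (omap F X)))" (is "is_nat_iso C C _ _ ?\<eta>")
    unfolding is_nat_iso_def
  proof (intro conjI ballI)
    fix X assume [simp]: "X \<in> Obj C"
    have [simp]: "omap F X \<in> Obj D" by (simp add: func)
    let ?\<theta> = "lift (obj (omap F X)) X (e (omap F X))"
    have "Comp C X (obj (omap F X)) X ?\<theta> (?\<eta> X) = Ident C X"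
      by (rule faithful[of X X]) (simp_all add: cat func ee')
    moreover have "Comp C (obj (omap F X)) X (obj (omap F X)) (?\<eta> X) ?\<theta> = Ident C (obj (omap F X))"
      by (rule faithful[of "obj (omap F X)" "obj (omap F X)"]) (simp_all add: cat func e'e)
    ultimately show "is_iso C (omap id_functor X) (omap (comp_functor G F) X) (?\<eta> X)"
      unfolding is_iso_def
      by (auto simp: id_functor_def comp_functor_def G_def intro!: bexI[of _ ?\<theta>])
  next
    fix X Y f assume [simp]: "X \<in> Obj C" "Y \<in> Obj C" "f \<in> Hom C X Y"
    have [simp]: "omap F X \<in> Obj D" "omap F Y \<in> Obj D" by (simp_all add: func)
    show "Comp C (omap id_functor X) (omap id_functor Y) (omap (comp_functor G F) Y) (?\<eta> Y)
        (mmap id_functor X Y f) = Comp C (omap id_functor X) (omap (comp_functor G F) X)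
        (omap (comp_functor G F) Y) (mmap (comp_functor G F) X Y f) (?\<eta> X)"
      unfolding id_functor_def comp_functor_def G_def functor_data.simps
      by (rule faithful[of X "obj (omap F Y)"]) (simp_all add: cat func conj_e')
  qed
  ultimately show ?thesis
    using C D F unfolding is_equivalence_def by blast
qed

section \<open>Ultrafilters of boolean lattices\<close>

context boolean_lattice
begin

lemma compl_closed [simp]: "x \<in> carrier L \<Longrightarrow> compl L x \<in> carrier L"
  by (rule compl_props)

lemma top_meet_right: "x \<in> carrier L \<Longrightarrow> x \<sqinter> \<top> = x"
  using top_meet[of x] by (simp add: eq_is_equal meet_comm)

lemma bottom_join_left: "x \<in> carrier L \<Longrightarrow> \<bottom> \<squnion> x = x"
  using bottom_join[of x] by (simp add: eq_is_equal)

text \<open>Turns a failed inequality into a nonzero element \<open>x \<sqinter> compl L y\<close>,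
  which an ultrafilter can contain or an atom can lie below.\<close>

lemma le_iff_meet_compl:
  assumes x: "x \<in> carrier L" and y: "y \<in> carrier L"
  shows "x \<sqsubseteq> y \<longleftrightarrow> x \<sqinter> compl L y = \<bottom>"
proof -
  have split: "x = (x \<sqinter> y) \<squnion> (x \<sqinter> compl L y)"
    using meet_join_distrib[OF x y, of "compl L y"] x y by (simp add: compl_props top_meet_right)
  show ?thesis
  proof
    assume "x \<sqsubseteq> y"
    hence "x \<sqinter> compl L y \<sqsubseteq> y \<sqinter> compl L y"
      using x y meet_left[of x "compl L y"] meet_right[of x "compl L y"]
      by (intro meet_le) (auto intro: le_trans)
    thus "x \<sqinter> compl L y = \<bottom>"
      using x y by (simp add: compl_props le_antisym)
  next
    assume "x \<sqinter> compl L y = \<bottom>"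
    hence "x = x \<sqinter> y"
      using split x y by (simp add: join_comm[of _ _ \<bottom>] bottom_join_left)
    thus "x \<sqsubseteq> y" using x y by (metis meet_right)
  qed
qed

lemma le_compl_iff:
  "\<lbrakk>x \<in> carrier L; y \<in> carrier L\<rbrakk> \<Longrightarrow> x \<sqsubseteq> compl L y \<longleftrightarrow> x \<sqinter> y = \<bottom>"
  by (simp add: le_iff_meet_compl compl_compl)

lemma le_compl_swap:
  "\<lbrakk>x \<in> carrier L; y \<in> carrier L\<rbrakk> \<Longrightarrow> x \<sqsubseteq> compl L y \<longleftrightarrow> y \<sqsubseteq> compl L x"
  by (simp add: le_compl_iff meet_comm)

lemma compl_le_compl_iff:
  "\<lbrakk>x \<in> carrier L; y \<in> carrier L\<rbrakk> \<Longrightarrow> compl L x \<sqsubseteq> compl L y \<longleftrightarrow> y \<sqsubseteq> x"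
  by (metis compl_closed compl_compl le_compl_swap)

lemma compl_top [simp]: "compl L \<top> = \<bottom>"
  by (rule compl_eqI) (simp_all add: meet_comm top_meet_right join_comm bottom_join_left
      meet_comm[of _ \<top>])

lemma compl_bottom [simp]: "compl L \<bottom> = \<top>"
  using compl_compl[of \<top>] by simp

lemma compl_meet:
  assumes x: "x \<in> carrier L" and y: "y \<in> carrier L"
  shows "compl L (x \<sqinter> y) = compl L x \<squnion> compl L y"
proof (rule le_antisym)
  have "compl L (compl L x \<squnion> compl L y) \<sqsubseteq> x \<sqinter> y"
    using x y by (intro meet_le)
      (metis compl_closed compl_compl compl_le_compl_iff join_closed join_left join_right)+
  thus "compl L (x \<sqinter> y) \<sqsubseteq> compl L x \<squnion> compl L y"
    using x y by (metis compl_closed compl_compl compl_le_compl_iff join_closed meet_closed)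
  show "compl L x \<squnion> compl L y \<sqsubseteq> compl L (x \<sqinter> y)"
    using x y by (intro join_le) (simp_all add: compl_le_compl_iff meet_left meet_right)
qed (use x y in simp_all)

lemma compl_join:
  "\<lbrakk>x \<in> carrier L; y \<in> carrier L\<rbrakk> \<Longrightarrow> compl L (x \<squnion> y) = compl L x \<sqinter> compl L y"
  using compl_compl compl_meet[of "compl L x" "compl L y"] by (metis compl_closed meet_closed)

lemma join_eq_compl_meet:
  "\<lbrakk>x \<in> carrier L; y \<in> carrier L\<rbrakk> \<Longrightarrow> x \<squnion> y = compl L (compl L x \<sqinter> compl L y)"
  by (simp add: compl_meet compl_compl)

end

text \<open>Membership in \<open>U\<close> is required to be a boolean homomorphism to the truth
  values; the filter laws follow from this. The one-element algebra has no ultrafilters, since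
  \<top> would have to be in and \<bottom> out.\<close>

definition ultrafilters :: "('a, 'b) gorder_scheme \<Rightarrow> 'a set set" where
  "ultrafilters L = {U. U \<subseteq> carrier L \<and>
     (\<forall>x\<in>carrier L. \<forall>y\<in>carrier L. x \<sqinter>\<^bsub>L\<^esub> y \<in> U \<longleftrightarrow> x \<in> U \<and> y \<in> U) \<and>
     (\<forall>x\<in>carrier L. compl L x \<in> U \<longleftrightarrow> x \<notin> U)}"

definition proper_filter :: "('a, 'b) gorder_scheme \<Rightarrow> 'a set \<Rightarrow> bool" where
  "proper_filter L F \<longleftrightarrow> F \<subseteq> carrier L \<and> \<top>\<^bsub>L\<^esub> \<in> F \<and> \<bottom>\<^bsub>L\<^esub> \<notin> F \<and>
     (\<forall>x\<in>F. \<forall>y\<in>F. x \<sqinter>\<^bsub>L\<^esub> y \<in> F) \<and>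
     (\<forall>x\<in>F. \<forall>y\<in>carrier L. x \<sqsubseteq>\<^bsub>L\<^esub> y \<longrightarrow> y \<in> F)"

text \<open>The generated filter may contain \<bottom>. The inductive form lets finite dependence on
  \<open>G\<close> be proved by following how an element is generated.\<close>

inductive_set filter_gen :: "('a, 'b) gorder_scheme \<Rightarrow> 'a set \<Rightarrow> 'a set"
  for L (structure) and G :: "'a set" where
  base: "x \<in> G \<Longrightarrow> x \<in> filter_gen L G"
| top: "\<top> \<in> filter_gen L G"
| meet: "\<lbrakk>x \<in> filter_gen L G; y \<in> filter_gen L G\<rbrakk> \<Longrightarrow> x \<sqinter> y \<in> filter_gen L G"
| up: "\<lbrakk>x \<in> filter_gen L G; y \<in> carrier L; x \<sqsubseteq> y\<rbrakk> \<Longrightarrow> y \<in> filter_gen L G"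

section \<open>Existence of ultrafilters and compactness\<close>

context boolean_lattice
begin

lemma ultrafilter_compl:
  "\<lbrakk>U \<in> ultrafilters L; x \<in> carrier L\<rbrakk> \<Longrightarrow> compl L x \<in> U \<longleftrightarrow> x \<notin> U"
  by (simp add: ultrafilters_def)

lemma ultrafilter_meet:
  "\<lbrakk>U \<in> ultrafilters L; x \<in> carrier L; y \<in> carrier L\<rbrakk> \<Longrightarrow> x \<sqinter> y \<in> U \<longleftrightarrow> x \<in> U \<and> y \<in> U"
  by (simp add: ultrafilters_def)

lemma ultrafilter_join:
  "\<lbrakk>U \<in> ultrafilters L; x \<in> carrier L; y \<in> carrier L\<rbrakk> \<Longrightarrow> x \<squnion> y \<in> U \<longleftrightarrow> x \<in> U \<or> y \<in> U"
  by (simp add: join_eq_compl_meet ultrafilter_compl ultrafilter_meet)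

lemma ultrafilter_up:
  "\<lbrakk>U \<in> ultrafilters L; x \<in> U; x \<sqsubseteq> y; x \<in> carrier L; y \<in> carrier L\<rbrakk> \<Longrightarrow> y \<in> U"
  by (metis le_iff_join ultrafilter_meet)

lemma ultrafilter_bottom:
  assumes "U \<in> ultrafilters L" shows "\<bottom> \<notin> U"
  using ultrafilter_compl[OF assms, of \<bottom>] ultrafilter_up[OF assms, of \<bottom> \<top>] by auto

lemma ultrafilter_top: "U \<in> ultrafilters L \<Longrightarrow> \<top> \<in> U"
  using ultrafilter_compl[of U \<bottom>] ultrafilter_bottom by simp

lemma ultrafilter_subset: "U \<in> ultrafilters L \<Longrightarrow> U \<subseteq> carrier L"
  by (simp add: ultrafilters_def)

text \<open>If neither \<open>x\<close> nor its complement is in \<open>F\<close>, the filter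
  \<open>G\<close> generated by \<open>F\<close> and \<open>x\<close> is a strictly larger proper
  filter: \<open>f \<sqinter> x = \<bottom>\<close> with \<open>f\<close> in \<open>F\<close> would
  put \<open>compl L x\<close> above \<open>f\<close> and hence into \<open>F\<close>.\<close>

lemma maximal_filter_ultrafilter:
  assumes F: "proper_filter L F" and max: "\<And>G. \<lbrakk>proper_filter L G; F \<subseteq> G\<rbrakk> \<Longrightarrow> G = F"
  shows "F \<in> ultrafilters L"
proof -
  have sub: "F \<subseteq> carrier L" and top: "\<top> \<in> F" and bot: "\<bottom> \<notin> F"
    and meet: "\<And>x y. \<lbrakk>x \<in> F; y \<in> F\<rbrakk> \<Longrightarrow> x \<sqinter> y \<in> F"
    and up: "\<And>x y. \<lbrakk>x \<in> F; y \<in> carrier L; x \<sqsubseteq> y\<rbrakk> \<Longrightarrow> y \<in> F"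
    using F by (auto simp: proper_filter_def)
  have "compl L x \<in> F" if x: "x \<in> carrier L" "x \<notin> F" for x
  proof (rule ccontr)
    assume nc: "compl L x \<notin> F"
    define G where "G = {z \<in> carrier L. \<exists>f\<in>F. f \<sqinter> x \<sqsubseteq> z}"
    have "f \<sqinter> x \<sqsubseteq> f" "f \<sqinter> x \<sqsubseteq> x" if "f \<in> F" for f
      using sub that x by (auto intro: meet_left meet_right)
    hence FG: "F \<subseteq> G" "x \<in> G"
      using sub top x unfolding G_def by blast+
    have "proper_filter L G"
      unfolding proper_filter_def
    proof (intro conjI ballI impI)
      show "\<top> \<in> G" using FG top by blast
      show "\<bottom> \<notin> G"
      proof
        assume "\<bottom> \<in> G"
        then obtain f where f: "f \<in> F" "f \<sqinter> x \<sqsubseteq> \<bottom>" by (auto simp: G_def)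
        have fc: "f \<in> carrier L" using f sub by blast
        have "f \<sqinter> x = \<bottom>"
          by (rule le_antisym) (simp_all add: f fc x)
        hence "f \<sqsubseteq> compl L x" using fc x by (simp add: le_compl_iff)
        thus False using f nc up x by auto
      qed
    next
      fix y z assume "y \<in> G" "z \<in> G"
      then obtain f g where *: "f \<in> F" "g \<in> F" "f \<sqinter> x \<sqsubseteq> y" "g \<sqinter> x \<sqsubseteq> z"
        "y \<in> carrier L" "z \<in> carrier L"
        by (auto simp: G_def)
      have fg: "f \<in> carrier L" "g \<in> carrier L" using * sub by auto
      have "f \<sqinter> g \<sqinter> x \<sqsubseteq> f \<sqinter> x" "f \<sqinter> g \<sqinter> x \<sqsubseteq> g \<sqinter> x"
        using fg x meet_left[OF meet_closed[OF fg] x(1)] meet_right[OF meet_closed[OF fg] x(1)]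
          meet_left[OF fg] meet_right[OF fg]
        by (meson le_trans meet_closed meet_le)+
      hence "f \<sqinter> g \<sqinter> x \<sqsubseteq> y \<sqinter> z"
        using * fg x by (meson le_trans meet_closed meet_le)
      thus "y \<sqinter> z \<in> G" using * meet[of f g] by (auto simp: G_def)
    next
      fix y z assume "y \<in> G" "z \<in> carrier L" "y \<sqsubseteq> z"
      thus "z \<in> G" using sub x unfolding G_def
        by (smt (verit) le_trans meet_closed mem_Collect_eq subsetD)
    qed (auto simp: G_def)
    thus False using max FG x by blast
  qed
  moreover have "x \<notin> F" if "x \<in> carrier L" "compl L x \<in> F" for x
    using that meet[of x "compl L x"] bot by (auto simp: compl_props)
  moreover have "x \<sqinter> y \<in> F \<longleftrightarrow> x \<in> F \<and> y \<in> F" if "x \<in> carrier L" "y \<in> carrier L" for x y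
    using that meet up[of "x \<sqinter> y"] meet_left[of x y] meet_right[of x y] by metis
  ultimately show ?thesis
    unfolding ultrafilters_def using sub by blast
qed

text \<open>Zorn's lemma. Two elements of the union of a chain already lie in one member of it, so
  the union is closed under meets; being proper is the condition that \<bottom> is absent, which
  passes to unions.\<close>

lemma proper_filter_extends:
  assumes F: "proper_filter L F"
  obtains U where "U \<in> ultrafilters L" "F \<subseteq> U"
proof -
  let ?P = "{G. proper_filter L G \<and> F \<subseteq> G}"
  have "\<exists>M\<in>?P. \<forall>X\<in>?P. M \<subseteq> X \<longrightarrow> X = M"
  proof (rule subset_Zorn_nonempty)
    show "?P \<noteq> {}" using F by blast
  next
    fix C assume C: "C \<noteq> {}" "subset.chain ?P C"
    hence "C \<subseteq> ?P" and ch: "G \<subseteq> H \<or> H \<subseteq> G" if "G \<in> C" "H \<in> C" for G H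
      using that by (simp_all add: subset_chain_def)
    hence D: "\<And>G. G \<in> C \<Longrightarrow> proper_filter L G \<and> F \<subseteq> G" by blast
    have meetC: "x \<sqinter> y \<in> \<Union>C" if "x \<in> G" "G \<in> C" "y \<in> H" "H \<in> C" for x y G H
    proof -
      have "G \<subseteq> H \<or> H \<subseteq> G" by (rule ch) fact+
      then obtain K where "K \<in> C" "x \<in> K" "y \<in> K" using \<open>x \<in> G\<close> \<open>G \<in> C\<close> \<open>y \<in> H\<close> \<open>H \<in> C\<close> by blast
      moreover from this have "x \<sqinter> y \<in> K" using D[of K] by (simp add: proper_filter_def)
      ultimately show ?thesis by blast
    qed
    have upC: "y \<in> \<Union>C" if "x \<in> G" "G \<in> C" "y \<in> carrier L" "x \<sqsubseteq> y" for x y G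
    proof -
      have "\<forall>x\<in>G. \<forall>y\<in>carrier L. x \<sqsubseteq> y \<longrightarrow> y \<in> G"
        using D[OF that(2)] by (simp add: proper_filter_def)
      thus ?thesis using that by blast
    qed
    have C': "\<Union>C \<subseteq> carrier L" "\<bottom> \<notin> \<Union>C" "\<top> \<in> \<Union>C"
    proof -
      have "G \<subseteq> carrier L" "\<bottom> \<notin> G" "\<top> \<in> G" if "G \<in> C" for G
        using D[OF that] by (simp_all add: proper_filter_def)
      thus "\<Union>C \<subseteq> carrier L" "\<bottom> \<notin> \<Union>C" "\<top> \<in> \<Union>C" using C(1) by blast+
    qed
    have "proper_filter L (\<Union>C)"
      unfolding proper_filter_def
    proof (intro conjI ballI impI C')
      fix x y assume "x \<in> \<Union>C" "y \<in> \<Union>C"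
      thus "x \<sqinter> y \<in> \<Union>C" using meetC by (elim UnionE)
    next
      fix x y assume "x \<in> \<Union>C" "y \<in> carrier L" "x \<sqsubseteq> y"
      thus "y \<in> \<Union>C" using upC by (elim UnionE)
    qed
    moreover have "F \<subseteq> \<Union>C"
    proof -
      obtain G where G: "G \<in> C" using C(1) by blast
      thus ?thesis using D[OF G] by blast
    qed
    ultimately show "\<Union>C \<in> ?P" by simp
  qed
  then obtain M where M: "proper_filter L M" "F \<subseteq> M" and max: "\<forall>X\<in>?P. M \<subseteq> X \<longrightarrow> X = M"
    by (elim bexE CollectE conjE)
  have "M \<in> ultrafilters L"
  proof (rule maximal_filter_ultrafilter[OF M(1)])
    fix G assume "proper_filter L G" "M \<subseteq> G"
    thus "G = M" using M(2) max by simp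
  qed
  thus thesis using M that by blast
qed

lemma filter_gen_carrier:
  assumes "G \<subseteq> carrier L" "x \<in> filter_gen L G"
  shows "x \<in> carrier L"
  using assms(2) by induction (use assms(1) in \<open>simp_all add: subset_iff\<close>)

text \<open>Stating finiteness through ultrafilters avoids meets of finite sets.\<close>

lemma filter_gen_finite:
  assumes "G \<subseteq> carrier L" "x \<in> filter_gen L G"
  shows "\<exists>T\<subseteq>G. finite T \<and> (\<forall>U\<in>ultrafilters L. T \<subseteq> U \<longrightarrow> x \<in> U)"
  using assms(2)
proof induction
  case (base x)
  thus ?case by (intro exI[of _ "{x}"]) auto
next
  case top
  show ?case by (intro exI[of _ "{}"]) (simp add: ultrafilter_top)
next
  case (meet x y)
  obtain S where "S \<subseteq> G" "finite S" "\<forall>U\<in>ultrafilters L. S \<subseteq> U \<longrightarrow> x \<in> U"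
    using meet.IH(1) by blast
  moreover obtain T where "T \<subseteq> G" "finite T" "\<forall>U\<in>ultrafilters L. T \<subseteq> U \<longrightarrow> y \<in> U"
    using meet.IH(2) by blast
  moreover have "x \<in> carrier L" "y \<in> carrier L"
    using meet.hyps filter_gen_carrier[OF assms(1)] by blast+
  ultimately show ?case
    by (intro exI[of _ "S \<union> T"]) (simp add: ultrafilter_meet)
next
  case (up x y)
  then obtain T where T: "T \<subseteq> G" "finite T" "\<forall>U\<in>ultrafilters L. T \<subseteq> U \<longrightarrow> x \<in> U" by blast
  have "x \<in> carrier L" using up.hyps(1) by (rule filter_gen_carrier[OF assms(1)])
  hence "\<forall>U\<in>ultrafilters L. T \<subseteq> U \<longrightarrow> y \<in> U"
    using T(3) up.hyps(2,3) by (metis ultrafilter_up)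
  thus ?case using T(1,2) by blast
qed

text \<open>If \<bottom> were generated by \<open>G\<close>, some finite part of \<open>G\<close>
  would force \<bottom> into every ultrafilter that contains this part, and by assumption there is
  such an ultrafilter.\<close>

lemma ultrafilter_exists_of_finite:
  assumes G: "G \<subseteq> carrier L"
    and fin: "\<And>T. \<lbrakk>T \<subseteq> G; finite T\<rbrakk> \<Longrightarrow> \<exists>U\<in>ultrafilters L. T \<subseteq> U"
  obtains U where "U \<in> ultrafilters L" "G \<subseteq> U"
proof -
  have "\<bottom> \<notin> filter_gen L G"
    using filter_gen_finite[OF G, of \<bottom>] fin ultrafilter_bottom by blast
  hence "proper_filter L (filter_gen L G)"
    using filter_gen_carrier[OF G] unfolding proper_filter_def
    by (simp add: subset_iff filter_gen.top filter_gen.meet) (metis filter_gen.up)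
  thus thesis
    using proper_filter_extends that by (metis filter_gen.base subset_iff)
qed

text \<open>Compactness of the Stone space, passing to complements: an ultrafilter that misses
  \<open>T\<close> contains the complements of its elements. So if no finite part of
  \<open>S\<close> meets every ultrafilter, some ultrafilter contains the complements of all of
  \<open>S\<close>, and it misses \<open>S\<close>.\<close>

lemma ultrafilters_compact:
  assumes S: "S \<subseteq> carrier L" and cover: "\<And>U. U \<in> ultrafilters L \<Longrightarrow> S \<inter> U \<noteq> {}"
  shows "\<exists>T\<subseteq>S. finite T \<and> (\<forall>U\<in>ultrafilters L. T \<inter> U \<noteq> {})"
proof (rule ccontr)
  assume no: "\<not> ?thesis"
  have "\<exists>U\<in>ultrafilters L. T \<subseteq> U" if T: "T \<subseteq> compl L ` S" "finite T" for T
  proof -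
    obtain T' where T': "T' \<subseteq> S" "finite T'" "T = compl L ` T'"
      using finite_subset_image[OF T(2,1)] by blast
    then obtain U where U: "U \<in> ultrafilters L" "T' \<inter> U = {}" using no by blast
    hence "T \<subseteq> U" using T' S ultrafilter_compl[OF U(1)] by blast
    thus ?thesis using U by blast
  qed
  moreover have "compl L ` S \<subseteq> carrier L" using S by auto
  ultimately obtain U where "U \<in> ultrafilters L" "compl L ` S \<subseteq> U"
    using ultrafilter_exists_of_finite[of "compl L ` S"] by blast
  thus False
    using cover[of U] S ultrafilter_compl[of U] by auto
qed

lemma proper_filter_principal:
  assumes "c \<in> carrier L" "c \<noteq> \<bottom>"
  shows "proper_filter L {x \<in> carrier L. c \<sqsubseteq> x}"
  unfolding proper_filter_def
  using assms by (auto intro: meet_le le_antisym) (meson le_trans)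

text \<open>An ultrafilter extending the principal filter of \<open>x \<sqinter> compl L y\<close>
  separates \<open>x\<close> from \<open>y\<close> when the inequality fails.\<close>

lemma le_iff_ultrafilters:
  assumes "x \<in> carrier L" "y \<in> carrier L"
  shows "x \<sqsubseteq> y \<longleftrightarrow> (\<forall>U\<in>ultrafilters L. x \<in> U \<longrightarrow> y \<in> U)"
proof
  assume R: "\<forall>U\<in>ultrafilters L. x \<in> U \<longrightarrow> y \<in> U"
  show "x \<sqsubseteq> y"
  proof (rule ccontr)
    assume "\<not> x \<sqsubseteq> y"
    hence "x \<sqinter> compl L y \<noteq> \<bottom>" using assms le_iff_meet_compl by blast
    then obtain U where "U \<in> ultrafilters L" "{z \<in> carrier L. x \<sqinter> compl L y \<sqsubseteq> z} \<subseteq> U"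
      using assms proper_filter_extends[OF proper_filter_principal] by (metis meet_closed compl_closed)
    moreover from this have "x \<sqinter> compl L y \<in> U" using assms by auto
    ultimately have "x \<in> U" "y \<notin> U" using assms by (simp_all add: ultrafilter_meet ultrafilter_compl)
    thus False using R \<open>U \<in> ultrafilters L\<close> by blast
  qed
qed (use assms ultrafilter_up in blast)

end

section \<open>Representation by sets\<close>

text \<open>A field of sets. Only the order of \<open>A\<close> enters the assumptions, so an
  interpretation both proves that \<open>A\<close> is a boolean lattice and computes its operations
  as those of sets.\<close>

locale set_repr =
  fixes A (structure) and f :: "'a \<Rightarrow> 'x set" and X :: "'x set"
  assumes eq_repr: "eq A = (=)"
    and inj_repr: "inj_on f (carrier A)"
    and le_repr: "\<lbrakk>x \<in> carrier A; y \<in> carrier A\<rbrakk> \<Longrightarrow> x \<sqsubseteq> y \<longleftrightarrow> f x \<subseteq> f y"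
    and repr_subset: "x \<in> carrier A \<Longrightarrow> f x \<subseteq> X"
    and repr_Int: "\<lbrakk>x \<in> carrier A; y \<in> carrier A\<rbrakk> \<Longrightarrow> \<exists>z\<in>carrier A. f z = f x \<inter> f y"
    and repr_Diff: "x \<in> carrier A \<Longrightarrow> \<exists>z\<in>carrier A. f z = X - f x"
    and repr_space: "\<exists>z\<in>carrier A. f z = X"
begin

lemma repr_eqD: "\<lbrakk>f x = f y; x \<in> carrier A; y \<in> carrier A\<rbrakk> \<Longrightarrow> x = y"
  using inj_repr by (rule inj_onD)

lemma repr_Un:
  assumes "x \<in> carrier A" "y \<in> carrier A"
  shows "\<exists>z\<in>carrier A. f z = f x \<union> f y"
proof -
  obtain x' y' where "x' \<in> carrier A" "f x' = X - f x" "y' \<in> carrier A" "f y' = X - f y"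
    using assms repr_Diff by metis
  moreover from this obtain z where "z \<in> carrier A" "f z = f x' \<inter> f y'"
    using repr_Int by metis
  moreover from this obtain w where "w \<in> carrier A" "f w = X - f z"
    using repr_Diff by metis
  moreover have "X - (X - f x) \<inter> (X - f y) = f x \<union> f y"
    using assms repr_subset by blast
  ultimately show ?thesis by metis
qed

lemma repr_empty: "\<exists>z\<in>carrier A. f z = {}"
  using repr_space repr_Diff by (metis Diff_cancel)

lemma repr_partial_order: "partial_order A"
proof unfold_locales
  fix x y assume "x \<sqsubseteq> y" "y \<sqsubseteq> x" "x \<in> carrier A" "y \<in> carrier A"
  thus "x .= y" by (simp add: eq_repr le_repr repr_eqD)
next
  fix x y z assume "x \<sqsubseteq> y" "y \<sqsubseteq> z" "x \<in> carrier A" "y \<in> carrier A" "z \<in> carrier A"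
  thus "x \<sqsubseteq> z" by (simp add: le_repr)
qed (simp_all add: eq_repr le_repr)

lemma lub_repr:
  "\<lbrakk>S \<subseteq> carrier A; z \<in> carrier A; f z = \<Union> (f ` S)\<rbrakk> \<Longrightarrow> is_lub A z S"
  by (rule least_UpperI) (auto simp: le_repr Upper_def subset_iff)

text \<open>The factor \<open>X\<close> matters for empty \<open>S\<close>, where the intersection
  alone would be the whole type instead of the value of the top element.\<close>

lemma glb_repr:
  "\<lbrakk>S \<subseteq> carrier A; z \<in> carrier A; f z = X \<inter> \<Inter> (f ` S)\<rbrakk> \<Longrightarrow> is_glb A z S"
  using repr_subset by (intro greatest_LowerI) (auto simp: le_repr Lower_def subset_iff)

lemma repr_bounded_lattice: "bounded_lattice A"
proof -
  interpret partial_order A by (rule repr_partial_order)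
  show ?thesis
  proof unfold_locales
    fix x y assume xy: "x \<in> carrier A" "y \<in> carrier A"
    obtain z where "z \<in> carrier A" "f z = f x \<union> f y" using repr_Un xy by metis
    thus "\<exists>s. is_lub A s {x, y}" using xy by (intro exI[of _ z] lub_repr) simp_all
    obtain z where "z \<in> carrier A" "f z = f x \<inter> f y" using repr_Int xy by metis
    moreover have "X \<inter> (f x \<inter> f y) = f x \<inter> f y" using repr_subset xy by blast
    ultimately show "\<exists>s. is_glb A s {x, y}" using xy by (intro exI[of _ z] glb_repr) simp_all
  next
    obtain z where "z \<in> carrier A" "f z = {}" using repr_empty by metis
    thus "\<exists>x. least A x (carrier A)" by (intro exI[of _ z]) (simp add: least_def le_repr)
    obtain z where "z \<in> carrier A" "f z = X" using repr_space by metis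
    thus "\<exists>x. greatest A x (carrier A)"
      by (intro exI[of _ z]) (simp add: greatest_def le_repr repr_subset)
  qed
qed

sublocale repr: bounded_lattice A by (rule repr_bounded_lattice)

lemma repr_meet:
  assumes xy: "x \<in> carrier A" "y \<in> carrier A"
  shows "f (x \<sqinter> y) = f x \<inter> f y"
proof -
  obtain z where z: "z \<in> carrier A" "f z = f x \<inter> f y" using repr_Int xy by metis
  have "z \<sqsubseteq> x \<sqinter> y" using z xy by (intro repr.meet_le) (simp_all add: le_repr)
  moreover have "x \<sqinter> y \<sqsubseteq> x" "x \<sqinter> y \<sqsubseteq> y"
    using xy repr.meet_left repr.meet_right by simp_all
  ultimately show ?thesis using z xy by (simp add: le_repr) blast
qed

lemma repr_join:
  assumes xy: "x \<in> carrier A" "y \<in> carrier A"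
  shows "f (x \<squnion> y) = f x \<union> f y"
proof -
  obtain z where z: "z \<in> carrier A" "f z = f x \<union> f y" using repr_Un xy by metis
  have "x \<squnion> y \<sqsubseteq> z" using z xy by (intro repr.join_le) (simp_all add: le_repr)
  moreover have "x \<sqsubseteq> x \<squnion> y" "y \<sqsubseteq> x \<squnion> y"
    using xy repr.join_left repr.join_right by simp_all
  ultimately show ?thesis using z xy by (simp add: le_repr) blast
qed

lemma repr_top: "f \<top> = X"
proof -
  obtain z where z: "z \<in> carrier A" "f z = X" using repr_space by metis
  moreover have "z \<sqsubseteq> \<top>" using z by simp
  ultimately show ?thesis using repr_subset[of \<top>] by (simp add: le_repr)
qed

lemma repr_bottom: "f \<bottom> = {}"
proof -
  obtain z where z: "z \<in> carrier A" "f z = {}" using repr_empty by metis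
  moreover have "\<bottom> \<sqsubseteq> z" using z by simp
  ultimately show ?thesis by (simp add: le_repr)
qed

lemma repr_boolean_lattice: "boolean_lattice A"
proof unfold_locales
  fix x y z assume "x \<in> carrier A" "y \<in> carrier A" "z \<in> carrier A"
  thus "x \<sqinter> (y \<squnion> z) = (x \<sqinter> y) \<squnion> (x \<sqinter> z)"
    by (intro repr_eqD) (simp_all add: repr_meet repr_join Int_Un_distrib)
next
  fix x assume x: "x \<in> carrier A"
  obtain y where y: "y \<in> carrier A" "f y = X - f x" using repr_Diff x by metis
  have "x \<sqinter> y = \<bottom>"
    by (rule repr_eqD) (simp_all add: x y repr_meet repr_bottom)
  moreover have "x \<squnion> y = \<top>"
    using repr_subset[OF x] by (intro repr_eqD) (simp_all add: x y repr_join repr_top Un_absorb1)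
  ultimately show "\<exists>y\<in>carrier A. x \<sqinter> y = \<bottom> \<and> x \<squnion> y = \<top>" using y by blast
qed

sublocale repr: boolean_lattice A by (rule repr_boolean_lattice)

lemma repr_compl:
  assumes x: "x \<in> carrier A"
  shows "f (compl A x) = X - f x"
proof -
  have "f x \<inter> f (compl A x) = {}" "f x \<union> f (compl A x) = X"
    using x repr.compl_props[OF x] by (metis repr_meet repr_bottom, metis repr_join repr_top)
  thus ?thesis by blast
qed

end

text \<open>Surjectivity onto \<open>Pow X\<close> is what turns infinite joins into unions. Under
  \<open>set_repr\<close> alone the union of infinitely many represented sets may fail to be
  represented, and the join is then strictly larger.\<close>

locale power_repr =
  fixes A (structure) and f :: "'a \<Rightarrow> 'x set" and X :: "'x set"
  assumes eq_power: "eq A = (=)"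
    and bij_power: "bij_betw f (carrier A) (Pow X)"
    and le_power: "\<lbrakk>x \<in> carrier A; y \<in> carrier A\<rbrakk> \<Longrightarrow> x \<sqsubseteq> y \<longleftrightarrow> f x \<subseteq> f y"
begin

lemma power_ex: "V \<subseteq> X \<Longrightarrow> \<exists>z\<in>carrier A. f z = V"
  using bij_betw_imp_surj_on[OF bij_power] by (metis PowI imageE)

sublocale set_repr A f X
proof
  show sub: "f x \<subseteq> X" if "x \<in> carrier A" for x
    using bij_power that by (auto simp: bij_betw_def)
  show "\<exists>z\<in>carrier A. f z = f x \<inter> f y" if "x \<in> carrier A" "y \<in> carrier A" for x y
    using that sub by (intro power_ex) blast
qed (use bij_power in \<open>auto simp: eq_power le_power bij_betw_def intro: power_ex\<close>)

lemma power_complete_lattice: "complete_lattice A"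
proof unfold_locales
  fix S assume S: "S \<subseteq> carrier A"
  obtain z where "z \<in> carrier A" "f z = \<Union> (f ` S)"
    using power_ex[of "\<Union> (f ` S)"] S repr_subset by blast
  thus "\<exists>s. is_lub A s S" using lub_repr S by blast
  obtain z where "z \<in> carrier A" "f z = X \<inter> \<Inter> (f ` S)"
    using power_ex[of "X \<inter> \<Inter> (f ` S)"] by blast
  thus "\<exists>s. is_glb A s S" using glb_repr S by blast
qed

sublocale repr: complete_lattice A by (rule power_complete_lattice)

lemma repr_sup:
  assumes S: "S \<subseteq> carrier A"
  shows "f (\<Squnion>S) = \<Union> (f ` S)"
proof -
  obtain z where z: "z \<in> carrier A" "f z = \<Union> (f ` S)"
    using power_ex[of "\<Union> (f ` S)"] S repr_subset by blast
  hence "z = \<Squnion>S" using lub_repr[OF S z] repr.sup_lub[OF S] repr.least_unique by blast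
  thus ?thesis using z by simp
qed

lemma repr_inf:
  assumes S: "S \<subseteq> carrier A"
  shows "f (\<Sqinter>S) = X \<inter> \<Inter> (f ` S)"
proof -
  obtain z where z: "z \<in> carrier A" "f z = X \<inter> \<Inter> (f ` S)"
    using power_ex[of "X \<inter> \<Inter> (f ` S)"] by blast
  hence "z = \<Sqinter>S" using glb_repr[OF S z] repr.inf_glb[OF S] repr.greatest_unique by blast
  thus ?thesis using z by simp
qed

end

text \<open>All homomorphisms constructed below are, in set representations, preimage maps \<open>p\<^sup>-\<^sup>1\<close>.\<close>

lemma preimage_BA_hom:
  assumes "set_repr A f X" "set_repr B g Y" and h: "h \<in> carrier A \<rightarrow>\<^sub>E carrier B"
    and pre: "\<And>x. x \<in> carrier A \<Longrightarrow> g (h x) = {y \<in> Y. p y \<in> f x}" and p: "p \<in> Y \<rightarrow> X"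
  shows "h \<in> BA_hom A B"
proof -
  interpret A: set_repr A f X by fact
  interpret B: set_repr B g Y by fact
  have hc: "\<And>x. x \<in> carrier A \<Longrightarrow> h x \<in> carrier B" using h by blast
  have py: "\<And>y. y \<in> Y \<Longrightarrow> p y \<in> X" using p by blast
  have "h (x \<squnion>\<^bsub>A\<^esub> y) = h x \<squnion>\<^bsub>B\<^esub> h y" "h (x \<sqinter>\<^bsub>A\<^esub> y) = h x \<sqinter>\<^bsub>B\<^esub> h y"
    if "x \<in> carrier A" "y \<in> carrier A" for x y
    using that
    by (intro B.repr_eqD; auto simp: hc pre A.repr_join A.repr_meet B.repr_join B.repr_meet)+
  moreover have "h \<bottom>\<^bsub>A\<^esub> = \<bottom>\<^bsub>B\<^esub>" "h \<top>\<^bsub>A\<^esub> = \<top>\<^bsub>B\<^esub>"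
    by (intro B.repr_eqD; auto simp: hc pre py A.repr_bottom A.repr_top B.repr_bottom B.repr_top)+
  moreover have "h (compl A x) = compl B (h x)" if "x \<in> carrier A" for x
    using that py by (intro B.repr_eqD; auto simp: hc pre A.repr_compl B.repr_compl)
  moreover have "lattice A" "lattice B" ..
  ultimately show ?thesis
    using h by (simp add: BA_hom_def join_pres_def meet_pres_def)
qed

lemma preimage_sup_inf_pres:
  assumes "power_repr A f X" "power_repr B g Y" and h: "h \<in> carrier A \<rightarrow> carrier B"
    and pre: "\<And>x. x \<in> carrier A \<Longrightarrow> g (h x) = {y \<in> Y. p y \<in> f x}" and p: "p \<in> Y \<rightarrow> X"
  shows "sup_pres A B h" "inf_pres A B h"
proof -
  interpret A: power_repr A f X by fact
  interpret B: power_repr B g Y by fact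
  have hc: "\<And>x. x \<in> carrier A \<Longrightarrow> h x \<in> carrier B" using h by blast
  have py: "\<And>y. y \<in> Y \<Longrightarrow> p y \<in> X" using p by blast
  have cl: "complete_lattice A" "complete_lattice B" ..
  have "h (\<Squnion>\<^bsub>A\<^esub>S) = \<Squnion>\<^bsub>B\<^esub>(h ` S)" "h (\<Sqinter>\<^bsub>A\<^esub>S) = \<Sqinter>\<^bsub>B\<^esub>(h ` S)" if S: "S \<subseteq> carrier A" for S
  proof -
    have hS: "h ` S \<subseteq> carrier B" using S hc by blast
    have img: "g ` h ` S = (\<lambda>x. {y \<in> Y. p y \<in> f x}) ` S"
      using S by (auto simp: image_image pre subset_iff intro!: image_eqI)
    show "h (\<Squnion>\<^bsub>A\<^esub>S) = \<Squnion>\<^bsub>B\<^esub>(h ` S)"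
      using S hS by (intro B.repr_eqD) (auto simp: hc pre A.repr_sup B.repr_sup img)
    show "h (\<Sqinter>\<^bsub>A\<^esub>S) = \<Sqinter>\<^bsub>B\<^esub>(h ` S)"
      using S hS by (intro B.repr_eqD) (auto simp: hc pre py A.repr_inf B.repr_inf img)
  qed
  thus "sup_pres A B h" "inf_pres A B h"
    using cl by (simp_all add: sup_pres_def inf_pres_def)
qed

text \<open>Stone's representation: \<open>le_iff_ultrafilters\<close> gives the order embedding,
  and the closure conditions are the homomorphism properties of membership.\<close>

lemma (in boolean_lattice) ultrafilter_set_repr:
  "set_repr L (\<lambda>x. {U \<in> ultrafilters L. x \<in> U}) (ultrafilters L)"
proof
  show "inj_on (\<lambda>x. {U \<in> ultrafilters L. x \<in> U}) (carrier L)"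
  proof (rule inj_onI)
    fix x y assume xy: "x \<in> carrier L" "y \<in> carrier L"
      and eq: "{U \<in> ultrafilters L. x \<in> U} = {U \<in> ultrafilters L. y \<in> U}"
    have "\<And>U. U \<in> ultrafilters L \<Longrightarrow> x \<in> U \<longleftrightarrow> y \<in> U" using eq by blast
    thus "x = y" using xy by (intro le_antisym) (simp_all add: le_iff_ultrafilters)
  qed
next
  fix x y assume xy: "x \<in> carrier L" "y \<in> carrier L"
  show "x \<sqsubseteq> y \<longleftrightarrow> {U \<in> ultrafilters L. x \<in> U} \<subseteq> {U \<in> ultrafilters L. y \<in> U}"
    using xy by (auto simp: le_iff_ultrafilters)
  show "\<exists>z\<in>carrier L. {U \<in> ultrafilters L. z \<in> U} =
      {U \<in> ultrafilters L. x \<in> U} \<inter> {U \<in> ultrafilters L. y \<in> U}"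
    using xy by (intro bexI[of _ "x \<sqinter> y"]) (auto simp: ultrafilter_meet)
next
  fix x assume "x \<in> carrier L"
  thus "\<exists>z\<in>carrier L. {U \<in> ultrafilters L. z \<in> U} =
      ultrafilters L - {U \<in> ultrafilters L. x \<in> U}"
    by (intro bexI[of _ "compl L x"]) (auto simp: ultrafilter_compl)
next
  show "\<exists>z\<in>carrier L. {U \<in> ultrafilters L. z \<in> U} = ultrafilters L"
    by (intro bexI[of _ "\<top>"]) (auto simp: ultrafilter_top)
qed (auto simp: eq_is_equal)

section \<open>Clopen elements and the functor clp\<close>

context mt_algebra
begin

lemma closed_iff_compl_open:
  assumes "a \<in> carrier M"
  shows "a \<in> closeds M \<longleftrightarrow> compl M a \<in> opens M"
proof -
  have "a = compl M (box M (compl M a)) \<longleftrightarrow> compl M a = box M (compl M a)"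
    using assms by (metis box_closed compl_closed compl_compl)
  thus ?thesis using assms by (simp add: closeds_def opens_def dia_def)
qed

lemma opens_carrier: "opens M \<subseteq> carrier M"
  by (auto simp: opens_def)

lemma closeds_carrier: "closeds M \<subseteq> carrier M"
  by (auto simp: closeds_def)

lemma clopens_carrier: "clopens M \<subseteq> carrier M"
  using opens_carrier by (auto simp: clopens_def)

lemma clopens_iff: "a \<in> carrier M \<Longrightarrow> a \<in> clopens M \<longleftrightarrow> a \<in> opens M \<and> compl M a \<in> opens M"
  by (auto simp: clopens_def closed_iff_compl_open)

lemma clopens_eq: "clopens M = {a \<in> carrier M. a \<in> opens M \<and> compl M a \<in> opens M}"
  using clopens_carrier clopens_iff by blast

lemma clopenD: "a \<in> clopens M \<Longrightarrow> a \<in> carrier M" "a \<in> clopens M \<Longrightarrow> a \<in> opens M"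
  using clopens_carrier by (auto simp: clopens_def)

lemma box_mono:
  assumes "a \<in> carrier M" "b \<in> carrier M" "a \<sqsubseteq> b"
  shows "box M a \<sqsubseteq> box M b"
proof -
  have "box M a = box M a \<sqinter> box M b"
    using assms box_meet[of a b] le_iff_join[of a b] by simp
  thus ?thesis using assms by (simp add: le_iff_join box_closed)
qed

lemma open_le_box: "\<lbrakk>a \<in> opens M; b \<in> carrier M; a \<sqsubseteq> b\<rbrakk> \<Longrightarrow> a \<sqsubseteq> box M b"
  using box_mono[of a b] by (simp add: opens_def)

lemma opens_meet: "\<lbrakk>a \<in> opens M; b \<in> opens M\<rbrakk> \<Longrightarrow> a \<sqinter> b \<in> opens M"
  by (simp add: opens_def box_meet)

lemma opens_top: "\<top> \<in> opens M"
  by (simp add: opens_def box_top)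

lemma opens_join:
  assumes "a \<in> opens M" "b \<in> opens M"
  shows "a \<squnion> b \<in> opens M"
proof -
  have ab: "a \<in> carrier M" "b \<in> carrier M" using assms opens_carrier by auto
  have "a \<squnion> b \<sqsubseteq> box M (a \<squnion> b)"
    using ab assms by (intro join_le open_le_box) (simp_all add: box_closed join_left join_right)
  thus ?thesis
    using ab by (simp add: opens_def) (simp add: box_closed box_le le_antisym)
qed

lemma opens_bottom: "\<bottom> \<in> opens M"
  using box_le[of \<bottom>] by (simp add: opens_def box_closed le_antisym)

lemma clopens_compl: "a \<in> clopens M \<Longrightarrow> compl M a \<in> clopens M"
  by (simp add: clopens_eq compl_compl)

lemma clopens_meet: "\<lbrakk>a \<in> clopens M; b \<in> clopens M\<rbrakk> \<Longrightarrow> a \<sqinter> b \<in> clopens M"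
  by (simp add: clopens_eq compl_meet opens_meet opens_join)

lemma clopens_join: "\<lbrakk>a \<in> clopens M; b \<in> clopens M\<rbrakk> \<Longrightarrow> a \<squnion> b \<in> clopens M"
  by (simp add: clopens_eq compl_join opens_meet opens_join)

lemma clopens_top: "\<top> \<in> clopens M"
  by (simp add: clopens_iff opens_top opens_bottom)

lemma clopens_bottom: "\<bottom> \<in> clopens M"
  by (simp add: clopens_iff opens_top opens_bottom)

lemma carrier_clp [simp]: "carrier (clp_algebra M) = clopens M"
  and le_clp [simp]: "le (clp_algebra M) = le M"
  by (simp_all add: clp_algebra_def)

text \<open>The points are the ultrafilters of all of \<open>M\<close>, not those of
  \<open>clp_algebra M\<close>. The map representing \<open>M\<close> thus also represents its
  clopens, and the operations of both algebras can be compared as sets.\<close>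

lemma clp_set_repr:
  "set_repr (clp_algebra M) (\<lambda>x. {U \<in> ultrafilters M. x \<in> U}) (ultrafilters M)"
proof -
  interpret U: set_repr M "\<lambda>x. {U \<in> ultrafilters M. x \<in> U}" "ultrafilters M"
    by (rule ultrafilter_set_repr)
  show ?thesis
  proof (unfold_locales, unfold carrier_clp le_clp)
    show "inj_on (\<lambda>x. {U \<in> ultrafilters M. x \<in> U}) (clopens M)"
      using U.inj_repr clopens_carrier by (rule inj_on_subset)
  next
    fix x y assume "x \<in> clopens M" "y \<in> clopens M"
    thus "\<exists>z\<in>clopens M. {U \<in> ultrafilters M. z \<in> U} =
        {U \<in> ultrafilters M. x \<in> U} \<inter> {U \<in> ultrafilters M. y \<in> U}"
      by (intro bexI[of _ "x \<sqinter> y"] U.repr_meet) (simp_all add: clopenD clopens_meet)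
  next
    fix x assume "x \<in> clopens M"
    thus "\<exists>z\<in>clopens M. {U \<in> ultrafilters M. z \<in> U} =
        ultrafilters M - {U \<in> ultrafilters M. x \<in> U}"
      by (intro bexI[of _ "compl M x"] U.repr_compl) (simp_all add: clopenD clopens_compl)
  next
    show "\<exists>z\<in>clopens M. {U \<in> ultrafilters M. z \<in> U} = ultrafilters M"
      by (intro bexI[of _ "\<top>"] U.repr_top) (simp add: clopens_top)
  next
    fix x y assume "x \<in> clopens M" "y \<in> clopens M"
    thus "x \<sqsubseteq> y \<longleftrightarrow> {U \<in> ultrafilters M. x \<in> U} \<subseteq> {U \<in> ultrafilters M. y \<in> U}"
      by (intro U.le_repr) (simp_all add: clopenD)
  qed (simp_all add: clp_algebra_def Collect_subset)
qed

sublocale clp: boolean_lattice "clp_algebra M"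
  using clp_set_repr by (rule set_repr.repr_boolean_lattice)

text \<open>The operations of \<open>clp_algebra M\<close> are determined by the order among clopens
  only. They agree with those of \<open>M\<close> because the common representation sends both to
  the same set.\<close>

lemma clp_meet: "\<lbrakk>a \<in> clopens M; b \<in> clopens M\<rbrakk> \<Longrightarrow> a \<sqinter>\<^bsub>clp_algebra M\<^esub> b = a \<sqinter> b"
  and clp_join: "\<lbrakk>a \<in> clopens M; b \<in> clopens M\<rbrakk> \<Longrightarrow> a \<squnion>\<^bsub>clp_algebra M\<^esub> b = a \<squnion> b"
  and clp_compl: "a \<in> clopens M \<Longrightarrow> compl (clp_algebra M) a = compl M a"
  and clp_top: "\<top>\<^bsub>clp_algebra M\<^esub> = \<top>" and clp_bottom: "\<bottom>\<^bsub>clp_algebra M\<^esub> = \<bottom>"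
proof -
  interpret U: set_repr M "\<lambda>x. {U \<in> ultrafilters M. x \<in> U}" "ultrafilters M"
    by (rule ultrafilter_set_repr)
  interpret C: set_repr "clp_algebra M" "\<lambda>x. {U \<in> ultrafilters M. x \<in> U}" "ultrafilters M"
    by (rule clp_set_repr)
  show "a \<sqinter>\<^bsub>clp_algebra M\<^esub> b = a \<sqinter> b" "a \<squnion>\<^bsub>clp_algebra M\<^esub> b = a \<squnion> b"
    if "a \<in> clopens M" "b \<in> clopens M"
    using that C.repr_meet[of a b] U.repr_meet[of a b] C.repr_join[of a b] U.repr_join[of a b]
    by (intro C.repr_eqD; simp add: clopenD clopens_meet clopens_join
        clp.meet_closed[simplified] clp.join_closed[simplified])+
  show "compl (clp_algebra M) a = compl M a" if "a \<in> clopens M"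
    using that C.repr_compl[of a] U.repr_compl[of a]
    by (intro C.repr_eqD; simp add: clopenD clopens_compl clp.compl_closed[simplified])
  show "\<top>\<^bsub>clp_algebra M\<^esub> = \<top>"
    using HOL.trans[OF C.repr_top U.repr_top[symmetric]] clp.top_closed
    by (intro C.repr_eqD) (simp_all add: clopens_top)
  show "\<bottom>\<^bsub>clp_algebra M\<^esub> = \<bottom>"
    using HOL.trans[OF C.repr_bottom U.repr_bottom[symmetric]] clp.bottom_closed
    by (intro C.repr_eqD) (simp_all add: clopens_bottom)
qed

end

section \<open>MT-morphisms, the two categories and the functor\<close>

lemma MT_homD:
  assumes "f \<in> MT_hom M N"
  shows "f \<in> carrier M \<rightarrow>\<^sub>E carrier N"
    and MT_hom_closed: "\<And>x. x \<in> carrier M \<Longrightarrow> f x \<in> carrier N"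
    and MT_hom_join: "\<And>x y. \<lbrakk>x \<in> carrier M; y \<in> carrier M\<rbrakk> \<Longrightarrow> f (x \<squnion>\<^bsub>M\<^esub> y) = f x \<squnion>\<^bsub>N\<^esub> f y"
    and MT_hom_meet: "\<And>x y. \<lbrakk>x \<in> carrier M; y \<in> carrier M\<rbrakk> \<Longrightarrow> f (x \<sqinter>\<^bsub>M\<^esub> y) = f x \<sqinter>\<^bsub>N\<^esub> f y"
    and MT_hom_bottom: "f \<bottom>\<^bsub>M\<^esub> = \<bottom>\<^bsub>N\<^esub>" and MT_hom_top: "f \<top>\<^bsub>M\<^esub> = \<top>\<^bsub>N\<^esub>"
    and MT_hom_compl: "\<And>x. x \<in> carrier M \<Longrightarrow> f (compl M x) = compl N (f x)"
    and MT_hom_sup: "\<And>S. S \<subseteq> carrier M \<Longrightarrow> f (\<Squnion>\<^bsub>M\<^esub>S) = \<Squnion>\<^bsub>N\<^esub>(f ` S)"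
    and MT_hom_inf: "\<And>S. S \<subseteq> carrier M \<Longrightarrow> f (\<Sqinter>\<^bsub>M\<^esub>S) = \<Sqinter>\<^bsub>N\<^esub>(f ` S)"
    and MT_hom_box: "\<And>x. x \<in> carrier M \<Longrightarrow> f (box M x) \<sqsubseteq>\<^bsub>N\<^esub> box N (f x)"
  using assms
  by (auto simp: MT_hom_def BA_hom_def join_pres_def meet_pres_def sup_pres_def inf_pres_def)

lemma MT_hom_mono:
  assumes "mt_algebra M" "mt_algebra N" "f \<in> MT_hom M N"
    and "x \<in> carrier M" "y \<in> carrier M" "x \<sqsubseteq>\<^bsub>M\<^esub> y"
  shows "f x \<sqsubseteq>\<^bsub>N\<^esub> f y"
proof -
  interpret M: mt_algebra M by fact
  interpret N: mt_algebra N by fact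
  have "f x = f x \<sqinter>\<^bsub>N\<^esub> f y"
    using assms(4-6) MT_hom_meet[OF assms(3)] by (metis M.le_iff_join)
  thus ?thesis
    using assms(4,5) MT_hom_closed[OF assms(3)] by (metis N.le_iff_join)
qed

text \<open>For open \<open>a\<close> the inequality for \<open>box\<close> reads
  \<open>f a \<sqsubseteq> box N (f a)\<close>, and the reverse one holds for every element.\<close>

lemma MT_hom_opens:
  assumes "mt_algebra M" "mt_algebra N" "f \<in> MT_hom M N" "a \<in> opens M"
  shows "f a \<in> opens N"
proof -
  interpret N: mt_algebra N by fact
  have a: "a \<in> carrier M" "box M a = a" using assms(4) by (auto simp: opens_def)
  have "f a \<in> carrier N" using a MT_hom_closed[OF assms(3)] by blast
  moreover have "f a \<sqsubseteq>\<^bsub>N\<^esub> box N (f a)" using MT_hom_box[OF assms(3) a(1)] a(2) by simp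
  ultimately show ?thesis
    by (simp add: opens_def) (simp add: N.box_closed N.box_le N.le_antisym)
qed

lemma MT_hom_clopens:
  assumes "mt_algebra M" "mt_algebra N" "f \<in> MT_hom M N" "a \<in> clopens M"
  shows "f a \<in> clopens N"
proof -
  interpret M: mt_algebra M by fact
  interpret N: mt_algebra N by fact
  have a: "a \<in> carrier M" using assms(4) by (rule M.clopenD)
  have "a \<in> opens M" "compl M a \<in> opens M" using M.clopens_iff[OF a] assms(4) by simp_all
  thus ?thesis
    using MT_hom_opens[OF assms(1-3)] MT_hom_compl[OF assms(3) a] MT_hom_closed[OF assms(3) a]
    by (metis N.clopens_iff)
qed

text \<open>The inequalities for \<open>box\<close> chain through \<open>g (box N (f a))\<close>;
  the first link needs \<open>g\<close> to be monotone, since \<open>f\<close> satisfies an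
  inequality only.\<close>

lemma MT_hom_compose:
  assumes M: "mt_algebra M" and N: "mt_algebra N" and K: "mt_algebra K"
    and f: "f \<in> MT_hom M N" and g: "g \<in> MT_hom N K"
  shows "compose (carrier M) g f \<in> MT_hom M K"
proof -
  interpret M: mt_algebra M by fact
  interpret N: mt_algebra N by fact
  interpret K: mt_algebra K by fact
  note [simp] = MT_homD(2-)[OF f] MT_homD(2-)[OF g]
  have c: "compose (carrier M) g f \<in> carrier M \<rightarrow>\<^sub>E carrier K"
    by (auto simp: compose_def)
  have l: "lattice M" "lattice K" "complete_lattice M" "complete_lattice K" ..
  have sup: "compose (carrier M) g f (\<Squnion>\<^bsub>M\<^esub>S) = \<Squnion>\<^bsub>K\<^esub>(compose (carrier M) g f ` S)"
    and inf: "compose (carrier M) g f (\<Sqinter>\<^bsub>M\<^esub>S) = \<Sqinter>\<^bsub>K\<^esub>(compose (carrier M) g f ` S)"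
    if S: "S \<subseteq> carrier M" for S
  proof -
    have i: "compose (carrier M) g f ` S = g ` f ` S" and s: "f ` S \<subseteq> carrier N"
      using S MT_hom_closed[OF f] by (auto simp: compose_def image_image subset_iff intro!: image_cong)
    show "compose (carrier M) g f (\<Squnion>\<^bsub>M\<^esub>S) = \<Squnion>\<^bsub>K\<^esub>(compose (carrier M) g f ` S)"
      "compose (carrier M) g f (\<Sqinter>\<^bsub>M\<^esub>S) = \<Sqinter>\<^bsub>K\<^esub>(compose (carrier M) g f ` S)"
      unfolding i using S s by (simp_all add: compose_def)
  qed
  have "g (f (box M a)) \<sqsubseteq>\<^bsub>K\<^esub> box K (g (f a))" if a: "a \<in> carrier M" for a
  proof -
    have "g (f (box M a)) \<sqsubseteq>\<^bsub>K\<^esub> g (box N (f a))"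
      using a by (intro MT_hom_mono[OF N K g]) (simp_all add: M.box_closed N.box_closed)
    also have "\<dots> \<sqsubseteq>\<^bsub>K\<^esub> box K (g (f a))" using a by simp
    finally show ?thesis
      using a by (simp add: M.box_closed N.box_closed K.box_closed)
  qed
  thus ?thesis
    using c l sup inf
    by (simp add: MT_hom_def BA_hom_def join_pres_def meet_pres_def sup_pres_def inf_pres_def
        compose_eq M.box_closed)
qed

lemma BA_hom_compose:
  assumes f: "f \<in> BA_hom A B" and g: "g \<in> BA_hom B C" and "boolean_lattice A"
  shows "compose (carrier A) g f \<in> BA_hom A C"
proof -
  interpret A: boolean_lattice A by fact
  have [simp]: "\<And>x. x \<in> carrier A \<Longrightarrow> f x \<in> carrier B" "\<And>x. x \<in> carrier B \<Longrightarrow> g x \<in> carrier C"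
    using f g by (auto simp: BA_hom_def)
  have "compose (carrier A) g f \<in> carrier A \<rightarrow>\<^sub>E carrier C"
    by (auto simp: compose_def)
  thus ?thesis
    using f g by (simp add: BA_hom_def join_pres_def meet_pres_def compose_eq)
qed

lemma BA_hom_ident:
  assumes "boolean_lattice A"
  shows "(\<lambda>x\<in>carrier A. x) \<in> BA_hom A A"
proof -
  interpret A: boolean_lattice A by fact
  have "lattice A" ..
  thus ?thesis by (simp add: BA_hom_def join_pres_def meet_pres_def)
qed

lemma MT_hom_ident:
  assumes "mt_algebra M"
  shows "(\<lambda>x\<in>carrier M. x) \<in> MT_hom M M"
proof -
  interpret M: mt_algebra M by fact
  have "boolean_lattice M" "complete_lattice M" ..
  moreover have "(\<lambda>x\<in>carrier M. x) ` S = S" if "S \<subseteq> carrier M" for S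
    using that by (auto simp: subset_iff image_iff)
  ultimately show ?thesis
    using BA_hom_ident[of M] by (simp add: MT_hom_def sup_pres_def inf_pres_def M.box_closed)
qed

text \<open>Morphisms are \<open>undefined\<close> off the carrier, and so are the results of
  \<open>compose\<close>; hence the unit laws hold as equations between total functions and not just
  on the carrier.\<close>

lemma is_category_BA: "is_category (BA small)"
proof -
  have ext: "f \<in> extensional (carrier A)" "\<And>x. x \<in> carrier A \<Longrightarrow> f x \<in> carrier B"
    if "f \<in> BA_hom A B" for f A B
    using that by (auto simp: BA_hom_def PiE_def)
  have "compose (carrier A) f (\<lambda>x\<in>carrier A. x) = f" "compose (carrier A) (\<lambda>x\<in>carrier B. x) f = f"
    if "f \<in> BA_hom A B" for f A B
    using ext[OF that] by (auto simp: compose_def extensional_def fun_eq_iff)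
  moreover have "compose (carrier A) h (compose (carrier A) g f) =
      compose (carrier A) (compose (carrier B) h g) f"
    if "f \<in> BA_hom A B" for f g h A B
    using ext[OF that] by (auto simp: compose_def fun_eq_iff)
  ultimately show ?thesis
    by (auto simp: is_category_def BA_def intro: BA_hom_compose BA_hom_ident)
qed

lemma is_category_StoneMT: "is_category (StoneMT small)"
proof -
  have ext: "f \<in> extensional (carrier A)" "\<And>x. x \<in> carrier A \<Longrightarrow> f x \<in> carrier B"
    if "f \<in> MT_hom A B" for f A B
    using that by (auto simp: MT_hom_def BA_hom_def PiE_def)
  have "compose (carrier A) f (\<lambda>x\<in>carrier A. x) = f" "compose (carrier A) (\<lambda>x\<in>carrier B. x) f = f"
    if "f \<in> MT_hom A B" for f A B
    using ext[OF that] by (auto simp: compose_def extensional_def fun_eq_iff)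
  moreover have "compose (carrier A) h (compose (carrier A) g f) =
      compose (carrier A) (compose (carrier B) h g) f"
    if "f \<in> MT_hom A B" for f g h A B
    using ext[OF that] by (auto simp: compose_def fun_eq_iff)
  ultimately show ?thesis
    by (auto simp: is_category_def StoneMT_def stone_mt_def intro: MT_hom_compose MT_hom_ident)
qed

lemma clp_BA_hom:
  assumes M: "mt_algebra M" and N: "mt_algebra N" and f: "f \<in> MT_hom M N"
  shows "restrict f (clopens M) \<in> BA_hom (clp_algebra M) (clp_algebra N)"
proof -
  interpret M: mt_algebra M by fact
  interpret N: mt_algebra N by fact
  have "lattice (clp_algebra M)" "lattice (clp_algebra N)" ..
  moreover have "\<And>x. x \<in> clopens M \<Longrightarrow> f x \<in> clopens N" by (rule MT_hom_clopens[OF assms])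
  moreover note M.clopens_meet M.clopens_join M.clopens_compl M.clopens_top M.clopens_bottom
  ultimately show ?thesis
    using MT_homD(2-)[OF f]
    by (simp add: BA_hom_def join_pres_def meet_pres_def M.clopenD M.clp_meet M.clp_join M.clp_compl
        M.clp_top M.clp_bottom N.clp_meet N.clp_join N.clp_compl N.clp_top N.clp_bottom)
qed

lemma is_functor_clp: "is_functor (StoneMT small) (BA small) clp"
proof -
  have comp: "restrict (compose (carrier M) g f) (clopens M) =
      compose (clopens M) (restrict g (clopens N)) (restrict f (clopens M))"
    if "mt_algebra M" "mt_algebra N" "f \<in> MT_hom M N" for M N :: "'a mt" and f g
    using that MT_hom_clopens[OF that] mt_algebra.clopenD(1)[OF that(1)]
    by (auto simp: compose_def fun_eq_iff)
  have "restrict (\<lambda>x\<in>carrier M. x) (clopens M) = (\<lambda>x\<in>clopens M. x)"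
    if "mt_algebra M" for M :: "'a mt"
    using mt_algebra.clopenD(1)[OF that] by (auto simp: fun_eq_iff)
  moreover have "boolean_lattice (clp_algebra M)" "carrier (clp_algebra M) = clopens M"
    if "mt_algebra M" for M :: "'a mt"
  proof -
    interpret mt_algebra M by fact
    show "boolean_lattice (clp_algebra M)" "carrier (clp_algebra M) = clopens M"
      by (rule clp.boolean_lattice_axioms) simp
  qed
  ultimately show ?thesis
    by (simp add: is_functor_def StoneMT_def BA_def clp_def stone_mt_def clp_BA_hom comp)
qed

section \<open>Atoms of Stone MT-algebras\<close>

definition atoms :: "('a, 'b) gorder_scheme \<Rightarrow> 'a set" where
  "atoms L = {x \<in> carrier L. x \<noteq> \<bottom>\<^bsub>L\<^esub> \<and>
     (\<forall>y\<in>carrier L. y \<sqsubseteq>\<^bsub>L\<^esub> x \<longrightarrow> y = \<bottom>\<^bsub>L\<^esub> \<or> y = x)}"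

definition atoms_below :: "('a, 'b) gorder_scheme \<Rightarrow> 'a \<Rightarrow> 'a set" where
  "atoms_below L a = {x \<in> atoms L. x \<sqsubseteq>\<^bsub>L\<^esub> a}"

context boolean_lattice
begin

lemma le_bottom_iff: "x \<in> carrier L \<Longrightarrow> x \<sqsubseteq> \<bottom> \<longleftrightarrow> x = \<bottom>"
  by (metis bottom_closed bottom_lower le_antisym)

lemma le_and_le_compl:
  assumes "x \<in> carrier L" "a \<in> carrier L" "x \<sqsubseteq> a" "x \<sqsubseteq> compl L a"
  shows "x = \<bottom>"
  using assms meet_le[OF assms(3,4)] by (simp add: compl_props le_bottom_iff)

lemma atomD:
  assumes "x \<in> atoms L"
  shows atom_carrier: "x \<in> carrier L" and atom_nonzero: "x \<noteq> \<bottom>"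
    and atom_minimal: "\<lbrakk>y \<in> carrier L; y \<sqsubseteq> x; y \<noteq> \<bottom>\<rbrakk> \<Longrightarrow> y = x"
  using assms by (auto simp: atoms_def)

text \<open>\<open>x \<sqinter> a\<close> is \<bottom> or \<open>x\<close>. This is the complement
  law for the set of elements above \<open>x\<close>, which is therefore an ultrafilter.\<close>

lemma atom_le_compl_iff:
  assumes x: "x \<in> atoms L" and a: "a \<in> carrier L"
  shows "x \<sqsubseteq> compl L a \<longleftrightarrow> \<not> x \<sqsubseteq> a"
proof
  have xc: "x \<in> carrier L" by (rule atom_carrier[OF x])
  show "\<not> x \<sqsubseteq> a" if "x \<sqsubseteq> compl L a"
    using that le_and_le_compl[OF xc a] atom_nonzero[OF x] by blast
  show "x \<sqsubseteq> compl L a" if n: "\<not> x \<sqsubseteq> a"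
  proof -
    have "x \<sqinter> a = \<bottom>"
      using atom_minimal[OF x, of "x \<sqinter> a"] n xc a meet_left[of x a] meet_right[of x a]
      by (metis meet_closed)
    thus ?thesis using xc a by (simp add: le_compl_iff)
  qed
qed

end

text \<open>Atomicity gives the order embedding through \<open>x \<sqinter> compl L y\<close>. For
  surjectivity, if an atom \<open>x\<close> is not in \<open>V\<close>, then
  \<open>compl L x\<close> is an upper bound of \<open>V\<close> and so of its join; hence the join
  has no atoms below it except those in \<open>V\<close>.\<close>

lemma power_repr_atoms:
  assumes "boolean_lattice L" "complete_lattice L"
    and atomic: "\<And>a. \<lbrakk>a \<in> carrier L; a \<noteq> \<bottom>\<^bsub>L\<^esub>\<rbrakk> \<Longrightarrow> \<exists>x\<in>atoms L. x \<sqsubseteq>\<^bsub>L\<^esub> a"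
  shows "power_repr L (atoms_below L) (atoms L)"
proof -
  interpret boolean_lattice L by fact
  interpret complete_lattice L by fact
  have le: "a \<sqsubseteq>\<^bsub>L\<^esub> b \<longleftrightarrow> atoms_below L a \<subseteq> atoms_below L b"
    if a: "a \<in> carrier L" and b: "b \<in> carrier L" for a b
  proof
    assume ab: "a \<sqsubseteq>\<^bsub>L\<^esub> b"
    show "atoms_below L a \<subseteq> atoms_below L b"
    proof
      fix x assume "x \<in> atoms_below L a"
      hence x: "x \<in> atoms L" "x \<sqsubseteq>\<^bsub>L\<^esub> a" by (simp_all add: atoms_below_def)
      have "x \<sqsubseteq>\<^bsub>L\<^esub> b" using x(2) ab atom_carrier[OF x(1)] a b by (rule le_trans)
      thus "x \<in> atoms_below L b" using x(1) by (simp add: atoms_below_def)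
    qed
  next
    assume sub: "atoms_below L a \<subseteq> atoms_below L b"
    show "a \<sqsubseteq>\<^bsub>L\<^esub> b"
    proof (rule ccontr)
      assume "\<not> a \<sqsubseteq>\<^bsub>L\<^esub> b"
      hence "a \<sqinter>\<^bsub>L\<^esub> compl L b \<noteq> \<bottom>\<^bsub>L\<^esub>" using a b le_iff_meet_compl by blast
      then obtain x where x: "x \<in> atoms L" "x \<sqsubseteq>\<^bsub>L\<^esub> a \<sqinter>\<^bsub>L\<^esub> compl L b"
        using atomic[of "a \<sqinter>\<^bsub>L\<^esub> compl L b"] a b by auto
      have "x \<sqsubseteq>\<^bsub>L\<^esub> a" "x \<sqsubseteq>\<^bsub>L\<^esub> compl L b"
        using x a b atom_carrier[OF x(1)] le_trans[OF x(2)] meet_left[of a "compl L b"]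
          meet_right[of a "compl L b"] by simp_all
      thus False
        using sub x(1) b atom_le_compl_iff by (auto simp: atoms_below_def)
    qed
  qed
  have "V \<in> atoms_below L ` carrier L" if V: "V \<subseteq> atoms L" for V
  proof -
    have Vc: "V \<subseteq> carrier L" using V atom_carrier by blast
    have "x \<in> V" if x: "x \<in> atoms L" and le: "x \<sqsubseteq>\<^bsub>L\<^esub> \<Squnion>\<^bsub>L\<^esub>V" for x
    proof (rule ccontr)
      assume "x \<notin> V"
      have xc: "x \<in> carrier L" by (rule atom_carrier[OF x])
      have "v \<sqsubseteq>\<^bsub>L\<^esub> compl L x" if v: "v \<in> V" for v
      proof -
        have va: "v \<in> atoms L" using V v by blast
        have "\<not> v \<sqsubseteq>\<^bsub>L\<^esub> x"
          using atom_minimal[OF x] atomD(1,2)[OF va] v \<open>x \<notin> V\<close> by metis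
        thus ?thesis using va xc by (simp add: atom_le_compl_iff)
      qed
      hence "\<Squnion>\<^bsub>L\<^esub>V \<sqsubseteq>\<^bsub>L\<^esub> compl L x" using Vc xc by (intro sup_least) simp_all
      hence "x \<sqsubseteq>\<^bsub>L\<^esub> compl L x" using le_trans[OF le] xc Vc by simp
      thus False using x xc by (simp add: atom_le_compl_iff)
    qed
    hence "atoms_below L (\<Squnion>\<^bsub>L\<^esub>V) = V"
      using V sup_upper[OF Vc] unfolding atoms_below_def by blast
    thus ?thesis using Vc by (metis imageI sup_closed)
  qed
  hence "atoms_below L ` carrier L = Pow (atoms L)"
    by (auto simp: atoms_below_def)
  moreover have "inj_on (atoms_below L) (carrier L)"
    using le by (auto intro!: inj_onI le_antisym)
  ultimately show ?thesis
    by unfold_locales (simp_all add: eq_is_equal bij_betw_def le)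
qed

section \<open>From ultrafilters of clopens to atoms\<close>

locale stone_algebra = mt_algebra +
  assumes compact: "compact_mt M" and zero_dim: "zero_dim M"
begin

lemma open_eq_sup: "a \<in> opens M \<Longrightarrow> a = \<Squnion>{b \<in> clopens M. b \<sqsubseteq> a}"
  using zero_dim by (simp add: zero_dim_def)

lemma eq_sup_closeds: "a \<in> carrier M \<Longrightarrow> \<exists>S\<subseteq>closeds M. a = \<Squnion>S"
  using zero_dim by (simp add: zero_dim_def T1_def)

lemma nonzero_closed_below:
  assumes a: "a \<in> carrier M" "a \<noteq> \<bottom>"
  shows "\<exists>c\<in>closeds M. c \<noteq> \<bottom> \<and> c \<sqsubseteq> a"
proof -
  obtain S where S: "S \<subseteq> closeds M" "a = \<Squnion>S" using eq_sup_closeds[OF a(1)] by blast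
  have SM: "S \<subseteq> carrier M" using S(1) closeds_carrier by (rule subset_trans)
  have "\<exists>c\<in>S. c \<noteq> \<bottom>"
  proof (rule ccontr)
    assume "\<not> (\<exists>c\<in>S. c \<noteq> \<bottom>)"
    hence "\<Squnion>S \<sqsubseteq> \<bottom>" by (intro sup_least[OF SM]) auto
    thus False using a S(2) by (simp add: le_bottom_iff)
  qed
  thus ?thesis using S sup_upper[OF SM] by blast
qed

text \<open>The complement of \<open>c\<close> is open and hence the join of the clopens below it;
  complementation turns these into the clopens above \<open>c\<close>.\<close>

lemma closed_eq_inf:
  assumes c: "c \<in> closeds M"
  shows "c = \<Sqinter>{b \<in> clopens M. c \<sqsubseteq> b}"
proof -
  let ?B = "{b \<in> clopens M. c \<sqsubseteq> b}"
  have cc: "c \<in> carrier M" and B: "?B \<subseteq> carrier M"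
    using c closeds_carrier clopens_carrier by auto
  let ?d = "\<Sqinter>?B"
  have d: "?d \<in> carrier M" using B by simp
  have "c \<sqsubseteq> ?d" using B cc by (intro inf_greatest) auto
  moreover have "?d \<sqsubseteq> c"
  proof -
    have "compl M c = \<Squnion>{b \<in> clopens M. b \<sqsubseteq> compl M c}"
      using c cc by (intro open_eq_sup) (simp add: closed_iff_compl_open)
    also have "\<dots> \<sqsubseteq> compl M ?d"
    proof (rule sup_least)
      show "{b \<in> clopens M. b \<sqsubseteq> compl M c} \<subseteq> carrier M" using clopens_carrier by auto
    next
      fix b assume "b \<in> {b \<in> clopens M. b \<sqsubseteq> compl M c}"
      hence b: "b \<in> clopens M" "b \<in> carrier M" "b \<sqsubseteq> compl M c" using clopens_carrier by auto
      hence "compl M b \<in> ?B" using cc by (simp add: clopens_compl le_compl_swap)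
      hence "?d \<sqsubseteq> compl M b" using B by (intro inf_lower)
      thus "b \<sqsubseteq> compl M ?d" using b d by (simp add: le_compl_swap)
    qed (use d in simp)
    finally show ?thesis using cc d by (simp add: compl_le_compl_iff)
  qed
  ultimately show ?thesis using cc d by (simp add: le_antisym)
qed

lemma clp_ultrafilterD:
  assumes U: "U \<in> ultrafilters (clp_algebra M)"
  shows "U \<subseteq> clopens M"
    and "b \<in> clopens M \<Longrightarrow> compl M b \<in> U \<longleftrightarrow> b \<notin> U"
    and "\<lbrakk>a \<in> clopens M; b \<in> clopens M\<rbrakk> \<Longrightarrow> a \<squnion> b \<in> U \<longleftrightarrow> a \<in> U \<or> b \<in> U"
    and "\<bottom> \<notin> U" and "\<top> \<in> U"
  using clp.ultrafilter_subset[OF U] clp.ultrafilter_compl[OF U, of b]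
    clp.ultrafilter_join[OF U, of a b] clp.ultrafilter_bottom[OF U] clp.ultrafilter_top[OF U]
  by (simp_all add: clp_compl clp_join clp_bottom clp_top)

text \<open>The first conjunct is carried through the induction because \<open>U\<close> splits a
  join only if both parts are clopen.\<close>

lemma clp_ultrafilter_finite_sup:
  assumes U: "U \<in> ultrafilters (clp_algebra M)"
    and "finite T" "T \<subseteq> clopens M"
  shows "\<Squnion>T \<in> clopens M \<and> (\<Squnion>T \<in> U \<longrightarrow> T \<inter> U \<noteq> {})"
  using assms(2,3)
proof (induction T rule: finite_induct)
  case empty
  have "\<Squnion>{} = \<bottom>" using weak_sup_empty by (simp add: eq_is_equal)
  thus ?case using clp_ultrafilterD(4)[OF U] clopens_bottom by simp
next
  case (insert x T)
  hence x: "x \<in> clopens M" and T: "T \<subseteq> clopens M"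
    and IH: "\<Squnion>T \<in> clopens M" "\<Squnion>T \<in> U \<longrightarrow> T \<inter> U \<noteq> {}" by auto
  have "T \<subseteq> carrier M" using T clopens_carrier by (rule subset_trans)
  hence "\<Squnion>(insert x T) = x \<squnion> \<Squnion>T"
    using weak_sup_insert[of x T] x by (simp add: eq_is_equal clopenD)
  thus ?case
    using IH x clp_ultrafilterD(3)[OF U x IH(1)] by (auto simp: clopens_join)
qed

text \<open>If the meet were \<bottom>, the complements of the members of \<open>U\<close> would be
  an open cover. A finite subcover has join \<top>, which is in \<open>U\<close>, so
  \<open>U\<close> would contain one of these complements next to the member it came from.\<close>

lemma inf_ultrafilter_nonzero:
  assumes U: "U \<in> ultrafilters (clp_algebra M)"
  shows "\<Sqinter>U \<noteq> \<bottom>"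
proof
  assume zero: "\<Sqinter>U = \<bottom>"
  have Uc: "U \<subseteq> clopens M" by (rule clp_ultrafilterD(1)[OF U])
  have UM: "U \<subseteq> carrier M" using Uc clopens_carrier by (rule subset_trans)
  let ?S = "compl M ` U"
  have Sc: "?S \<subseteq> clopens M" using Uc clopens_compl by blast
  have SM: "?S \<subseteq> carrier M" using Sc clopens_carrier by (rule subset_trans)
  have S: "\<Squnion>?S \<in> carrier M" using SM by simp
  have "compl M (\<Squnion>?S) \<sqsubseteq> \<Sqinter>U"
  proof (rule inf_greatest[OF UM])
    fix u assume u: "u \<in> U"
    hence uM: "u \<in> carrier M" using UM by (rule_tac subsetD)
    have "compl M u \<sqsubseteq> \<Squnion>?S" using u by (intro sup_upper[OF SM]) simp
    thus "compl M (\<Squnion>?S) \<sqsubseteq> u"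
      using compl_le_compl_iff[of "\<Squnion>?S" "compl M u"] uM S by (simp add: compl_compl)
  qed (use S in simp)
  hence "compl M (\<Squnion>?S) = \<bottom>" using zero S by (simp add: le_bottom_iff)
  hence "\<Squnion>?S = \<top>" using S by (metis compl_bottom compl_compl)
  moreover have "?S \<subseteq> opens M" using Sc clopenD(2) by blast
  ultimately obtain T where T: "T \<subseteq> ?S" "finite T" "\<Squnion>T = \<top>"
    using compact unfolding compact_mt_def by meson
  have "T \<inter> U \<noteq> {}"
    using clp_ultrafilter_finite_sup[OF U T(2)] T Sc clp_ultrafilterD(5)[OF U] by auto
  then obtain u where "u \<in> U" "compl M u \<in> U" using T(1) by blast
  thus False using clp_ultrafilterD(2)[OF U] Uc by blast
qed

lemma inf_ultrafilter_closed: "U \<in> ultrafilters (clp_algebra M) \<Longrightarrow> \<Sqinter>U \<in> carrier M"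
  using clp_ultrafilterD(1) clopens_carrier by (metis inf_closed subset_trans)

text \<open>Either \<open>b\<close> or its complement is in \<open>U\<close> and so lies above the
  meet; both cannot, as the meet is nonzero. The ultrafilter is thereby recovered from its
  meet.\<close>

lemma inf_ultrafilter_le_iff:
  assumes U: "U \<in> ultrafilters (clp_algebra M)" and b: "b \<in> clopens M"
  shows "\<Sqinter>U \<sqsubseteq> b \<longleftrightarrow> b \<in> U"
proof -
  have UM: "U \<subseteq> carrier M"
    using clp_ultrafilterD(1)[OF U] clopens_carrier by (rule subset_trans)
  have le: "\<Sqinter>U \<sqsubseteq> a" if "a \<in> U" for a using UM that by (rule inf_lower)
  show ?thesis
  proof
    assume "\<Sqinter>U \<sqsubseteq> b"
    hence "\<not> \<Sqinter>U \<sqsubseteq> compl M b"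
      using le_and_le_compl[of "\<Sqinter>U" b] inf_ultrafilter_nonzero[OF U] inf_closed[OF UM] clopenD(1)[OF b]
      by blast
    thus "b \<in> U" using le clp_ultrafilterD(2)[OF U b] by blast
  qed (rule le)
qed

text \<open>Let \<open>c\<close> be closed, nonzero and below the meet. A clopen \<open>b\<close>
  above \<open>c\<close> is in \<open>U\<close>, since otherwise \<open>c\<close> would be below
  both \<open>b\<close> and its complement. So the meet of \<open>U\<close> is below all clopens
  above \<open>c\<close>, hence below \<open>c\<close>. Any nonzero \<open>y\<close> under the meet
  lies above such a \<open>c\<close>.\<close>

lemma inf_ultrafilter_atom:
  assumes U: "U \<in> ultrafilters (clp_algebra M)"
  shows "\<Sqinter>U \<in> atoms M"
proof -
  let ?d = "\<Sqinter>U"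
  have d: "?d \<in> carrier M" using U by (rule inf_ultrafilter_closed)
  have closed_eq: "c = ?d" if c: "c \<in> closeds M" "c \<noteq> \<bottom>" "c \<sqsubseteq> ?d" for c
  proof -
    have cM: "c \<in> carrier M" using c closeds_carrier by blast
    have B: "{b \<in> clopens M. c \<sqsubseteq> b} \<subseteq> carrier M" using clopens_carrier by blast
    have "?d \<sqsubseteq> b" if b: "b \<in> clopens M" "c \<sqsubseteq> b" for b
    proof (rule ccontr)
      assume "\<not> ?d \<sqsubseteq> b"
      hence "?d \<sqsubseteq> compl M b"
        using b(1) U by (simp add: inf_ultrafilter_le_iff clopens_compl clp_ultrafilterD)
      hence "c \<sqsubseteq> compl M b" using le_trans[OF c(3)] cM d clopenD(1)[OF b(1)] by simp
      thus False using le_and_le_compl[OF cM clopenD(1)[OF b(1)] b(2)] c(2) by blast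
    qed
    hence "?d \<sqsubseteq> c"
      using inf_greatest[OF B d] closed_eq_inf[OF c(1)] by simp
    thus ?thesis using c(3) cM d by (intro le_antisym)
  qed
  have "y = ?d" if y: "y \<in> carrier M" "y \<sqsubseteq> ?d" "y \<noteq> \<bottom>" for y
  proof -
    obtain c where c: "c \<in> closeds M" "c \<noteq> \<bottom>" and cy: "c \<sqsubseteq> y"
      using nonzero_closed_below[OF y(1,3)] by blast
    have cM: "c \<in> carrier M" using c(1) closeds_carrier by blast
    have "c \<sqsubseteq> ?d" using cy y(2) cM y(1) d by (rule le_trans)
    hence "c = ?d" using c by (intro closed_eq)
    thus ?thesis using cy y d by (simp add: le_antisym)
  qed
  thus ?thesis
    using d inf_ultrafilter_nonzero[OF U] by (auto simp: atoms_def)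
qed

text \<open>For a nonzero closed \<open>c\<close> below \<open>a\<close>, the clopens above
  \<open>c\<close> form a proper filter with meet \<open>c\<close>. Extending the filter to an
  ultrafilter can only lower the meet, and the lowered meet is an atom.\<close>

lemma atomic:
  assumes a: "a \<in> carrier M" "a \<noteq> \<bottom>"
  shows "\<exists>x\<in>atoms M. x \<sqsubseteq> a"
proof -
  obtain c where cc: "c \<in> closeds M" and c: "c \<noteq> \<bottom>" and ca: "c \<sqsubseteq> a"
    using nonzero_closed_below[OF a] by blast
  have cM: "c \<in> carrier M" using cc closeds_carrier by blast
  have "proper_filter (clp_algebra M) {b \<in> clopens M. c \<sqsubseteq> b}"
    unfolding proper_filter_def carrier_clp le_clp clp_top clp_bottom
  proof (intro conjI ballI impI)
    fix x y assume "x \<in> {b \<in> clopens M. c \<sqsubseteq> b}" "y \<in> {b \<in> clopens M. c \<sqsubseteq> b}"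
    thus "x \<sqinter>\<^bsub>clp_algebra M\<^esub> y \<in> {b \<in> clopens M. c \<sqsubseteq> b}"
      using cM by (simp add: clp_meet clopens_meet meet_le clopenD)
  next
    fix x y assume "x \<in> {b \<in> clopens M. c \<sqsubseteq> b}" "y \<in> clopens M" "x \<sqsubseteq> y"
    thus "y \<in> {b \<in> clopens M. c \<sqsubseteq> b}"
      using le_trans[of c x y] cM by (simp add: clopenD)
  qed (use c cM in \<open>auto simp: clopens_top le_bottom_iff\<close>)
  then obtain U where U: "U \<in> ultrafilters (clp_algebra M)" "{b \<in> clopens M. c \<sqsubseteq> b} \<subseteq> U"
    by (rule clp.proper_filter_extends)
  have B: "{b \<in> clopens M. c \<sqsubseteq> b} \<subseteq> carrier M" using clopens_carrier by blast
  have "\<Sqinter>U \<sqsubseteq> \<Sqinter>{b \<in> clopens M. c \<sqsubseteq> b}"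
    using U(2) inf_ultrafilter_le_iff[OF U(1)]
    by (intro inf_greatest[OF B inf_ultrafilter_closed[OF U(1)]]) blast
  hence "\<Sqinter>U \<sqsubseteq> c" using closed_eq_inf[OF cc] by simp
  hence "\<Sqinter>U \<sqsubseteq> a" using le_trans[OF _ ca] cM a(1) inf_ultrafilter_closed[OF U(1)] by blast
  thus ?thesis using inf_ultrafilter_atom[OF U(1)] by blast
qed

sublocale at: power_repr M "atoms_below M" "atoms M"
  by (rule power_repr_atoms) (unfold_locales, rule atomic)

end

section \<open>Faithfulness and fullness of clp\<close>

lemma stone_mtD: "stone_mt M \<Longrightarrow> stone_algebra M"
  by (simp add: stone_mt_def stone_algebra_def stone_algebra_axioms_def)

text \<open>Agreement spreads in two stages: to closed elements, as meets of clopens, and then to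
  all elements, as joins of closed ones.\<close>

lemma clp_faithful:
  assumes M: "stone_mt M" and N: "mt_algebra N" and f: "f \<in> MT_hom M N" and g: "g \<in> MT_hom M N"
    and eq: "restrict f (clopens M) = restrict g (clopens M)"
  shows "f = g"
proof (rule PiE_ext)
  interpret M: stone_algebra M using M by (rule stone_mtD)
  show "f \<in> carrier M \<rightarrow>\<^sub>E carrier N" "g \<in> carrier M \<rightarrow>\<^sub>E carrier N"
    using MT_homD(1) f g by blast+
  have clopen: "f b = g b" if "b \<in> clopens M" for b
    using fun_cong[OF eq, of b] that by simp
  have closed: "f c = g c" if c: "c \<in> closeds M" for c
  proof -
    let ?B = "{b \<in> clopens M. c \<sqsubseteq>\<^bsub>M\<^esub> b}"
    have "?B \<subseteq> carrier M" using M.clopens_carrier by blast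
    hence "f (\<Sqinter>\<^bsub>M\<^esub>?B) = \<Sqinter>\<^bsub>N\<^esub>(f ` ?B)" "g (\<Sqinter>\<^bsub>M\<^esub>?B) = \<Sqinter>\<^bsub>N\<^esub>(g ` ?B)"
      using MT_hom_inf f g by blast+
    moreover have "f ` ?B = g ` ?B" using clopen by (intro image_cong) auto
    ultimately show ?thesis using M.closed_eq_inf[OF c] by simp
  qed
  fix a assume "a \<in> carrier M"
  then obtain S where S: "S \<subseteq> closeds M" "a = \<Squnion>\<^bsub>M\<^esub>S" using M.eq_sup_closeds by blast
  have "S \<subseteq> carrier M" using S(1) M.closeds_carrier by (rule subset_trans)
  hence "f a = \<Squnion>\<^bsub>N\<^esub>(f ` S)" "g a = \<Squnion>\<^bsub>N\<^esub>(g ` S)"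
    using MT_hom_sup[OF f] MT_hom_sup[OF g] S(2) by simp_all
  moreover have "f ` S = g ` S" using S(1) closed by (intro image_cong) auto
  ultimately show "f a = g a" by simp
qed

lemma clp_full:
  assumes "stone_mt M" and "stone_mt N" and h: "h \<in> BA_hom (clp_algebra M) (clp_algebra N)"
  shows "\<exists>f\<in>MT_hom M N. restrict f (clopens M) = h"
proof -
  interpret M: stone_algebra M using assms(1) by (rule stone_mtD)
  interpret N: stone_algebra N using assms(2) by (rule stone_mtD)
  have h_ext: "h \<in> clopens M \<rightarrow>\<^sub>E clopens N" using h by (simp add: BA_hom_def)
  hence hc: "\<And>b. b \<in> clopens M \<Longrightarrow> h b \<in> clopens N" by blast
  have h_meet: "h (a \<sqinter>\<^bsub>M\<^esub> b) = h a \<sqinter>\<^bsub>N\<^esub> h b" if "a \<in> clopens M" "b \<in> clopens M" for a b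
    using h that by (simp add: BA_hom_def meet_pres_def M.clp_meet N.clp_meet hc)
  have h_compl: "h (compl M a) = compl N (h a)" if "a \<in> clopens M" for a
    using h that by (simp add: BA_hom_def M.clp_compl N.clp_compl hc)
  \<comment> \<open>The elements of \<open>N\<close> above the atom \<open>y\<close> form an
    ultrafilter; \<open>pt y\<close> is its inverse image under \<open>h\<close>.\<close>
  define pt where "pt y = {b \<in> clopens M. y \<sqsubseteq>\<^bsub>N\<^esub> h b}" for y
  have pt: "pt y \<in> ultrafilters (clp_algebra M)" if y: "y \<in> atoms N" for y
  proof -
    have "y \<sqsubseteq>\<^bsub>N\<^esub> a \<sqinter>\<^bsub>N\<^esub> b \<longleftrightarrow> y \<sqsubseteq>\<^bsub>N\<^esub> a \<and> y \<sqsubseteq>\<^bsub>N\<^esub> b" if "a \<in> carrier N" "b \<in> carrier N" for a b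
      using N.at.repr_meet[OF that] y by (auto simp: atoms_below_def)
    thus ?thesis
      using y unfolding ultrafilters_def pt_def
      by (simp add: M.clp_meet M.clp_compl M.clopens_meet M.clopens_compl h_meet h_compl hc
          N.clopenD N.atom_le_compl_iff subset_iff)
  qed
  define p where "p y = \<Sqinter>\<^bsub>M\<^esub>(pt y)" for y
  have p: "p \<in> atoms N \<rightarrow> atoms M"
    unfolding p_def using M.inf_ultrafilter_atom pt by blast
  \<comment> \<open>This equivalence is what makes the preimage map of \<open>p\<close> agree with
    \<open>h\<close> on clopens.\<close>
  have p_le: "p y \<sqsubseteq>\<^bsub>M\<^esub> b \<longleftrightarrow> y \<sqsubseteq>\<^bsub>N\<^esub> h b" if "y \<in> atoms N" "b \<in> clopens M" for y b
    unfolding p_def using M.inf_ultrafilter_le_iff[OF pt[OF that(1)] that(2)] that(2)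
    by (simp add: pt_def)
  \<comment> \<open>\<open>atoms_below N\<close> is a bijection onto \<open>Pow (atoms N)\<close>;
    its inverse turns the preimage under \<open>p\<close> of the atoms below \<open>a\<close> into
    an element of \<open>N\<close>.\<close>
  define f where "f = (\<lambda>a\<in>carrier M. inv_into (carrier N) (atoms_below N) {y \<in> atoms N. p y \<sqsubseteq>\<^bsub>M\<^esub> a})"
  have f: "f a \<in> carrier N" "atoms_below N (f a) = {y \<in> atoms N. p y \<sqsubseteq>\<^bsub>M\<^esub> a}"
    if "a \<in> carrier M" for a
  proof -
    have "{y \<in> atoms N. p y \<sqsubseteq>\<^bsub>M\<^esub> a} \<in> atoms_below N ` carrier N"
      using bij_betw_imp_surj_on[OF N.at.bij_power] by auto
    thus "f a \<in> carrier N" "atoms_below N (f a) = {y \<in> atoms N. p y \<sqsubseteq>\<^bsub>M\<^esub> a}"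
      unfolding f_def using that by (simp_all only: restrict_apply' inv_into_into f_inv_into_f)
  qed
  have f_ext: "f \<in> carrier M \<rightarrow>\<^sub>E carrier N" using f(1) by (auto simp: f_def)
  have pre: "atoms_below N (f a) = {y \<in> atoms N. p y \<in> atoms_below M a}" if "a \<in> carrier M" for a
    using f(2)[OF that] p by (auto simp: atoms_below_def)
  have fh: "f b = h b" if b: "b \<in> clopens M" for b
  proof (rule N.at.repr_eqD)
    show "atoms_below N (f b) = atoms_below N (h b)"
      using f(2)[OF M.clopenD(1)[OF b]] p_le[OF _ b] by (auto simp: atoms_below_def)
  qed (use b f(1) M.clopenD hc N.clopenD in blast)+
  have f_mono: "f a \<sqsubseteq>\<^bsub>N\<^esub> f b" if "a \<in> carrier M" "b \<in> carrier M" "a \<sqsubseteq>\<^bsub>M\<^esub> b" for a b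
    using that M.at.le_repr[of a b] by (auto simp: N.at.le_repr f(1) pre)
  have BA: "f \<in> BA_hom M N"
    by (rule preimage_BA_hom[OF M.at.set_repr_axioms N.at.set_repr_axioms f_ext pre p])
  have pres: "sup_pres M N f" "inf_pres M N f"
    using f_ext by (intro preimage_sup_inf_pres[OF M.at.power_repr_axioms N.at.power_repr_axioms _ pre p]; blast)+
  have "f (box M a) \<sqsubseteq>\<^bsub>N\<^esub> box N (f a)" if a: "a \<in> carrier M" for a
  proof -
    \<comment> \<open>Each \<open>b\<close> in \<open>?B\<close> has an open image
      \<open>f b = h b\<close> below \<open>f a\<close>, hence below \<open>box N (f a)\<close>; as
      \<open>f\<close> preserves joins, the bound passes to the open element
      \<open>box M a\<close>.\<close>
    let ?B = "{b \<in> clopens M. b \<sqsubseteq>\<^bsub>M\<^esub> box M a}"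
    have B: "?B \<subseteq> carrier M" using M.clopens_carrier by blast
    have box: "box M a \<in> carrier M" "box M a \<sqsubseteq>\<^bsub>M\<^esub> a" "box M a \<in> opens M"
      using a M.box_closed[OF a] M.box_le[OF a] M.box_le_box_box[OF a] M.box_le[OF M.box_closed[OF a]]
      by (auto simp: opens_def intro!: M.le_antisym M.box_closed)
    have "f (box M a) = \<Squnion>\<^bsub>N\<^esub>(f ` ?B)"
      using pres(1) B unfolding sup_pres_def by (subst M.open_eq_sup[OF box(3)]) blast
    also have "\<dots> \<sqsubseteq>\<^bsub>N\<^esub> box N (f a)"
    proof (rule N.sup_least)
      show "f ` ?B \<subseteq> carrier N" using B f(1) by blast
      fix z assume "z \<in> f ` ?B"
      then obtain b where b: "z = f b" "b \<in> clopens M" "b \<sqsubseteq>\<^bsub>M\<^esub> box M a" by blast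
      have bM: "b \<in> carrier M" using b(2) by (rule M.clopenD)
      have "b \<sqsubseteq>\<^bsub>M\<^esub> a" using M.le_trans[OF b(3) box(2) bM box(1) a] .
      moreover have "f b \<in> opens N" using fh[OF b(2)] hc[OF b(2)] N.clopenD(2) by simp
      ultimately show "z \<sqsubseteq>\<^bsub>N\<^esub> box N (f a)"
        unfolding b(1) using f_mono[OF bM a] f(1)[OF a] by (intro N.open_le_box)
    qed (use a f N.box_closed in blast)
    finally show ?thesis .
  qed
  hence "f \<in> MT_hom M N" using BA pres by (simp add: MT_hom_def)
  moreover have "restrict f (clopens M) = h"
    using h_ext fh by (intro PiE_ext[of _ "clopens M" "\<lambda>_. clopens N"]) (auto simp: hc)
  ultimately show ?thesis by blast
qed

section \<open>The Stone MT-algebra of a boolean algebra\<close>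

text \<open>\<open>K\<close> is the algebra of clopen sets of a Stone topology on \<open>X\<close>. The points need not live in the type
  of the objects of the category, so the subsets of \<open>X\<close> are transported along an injection \<open>enc\<close>.\<close>

locale stone_space =
  fixes X :: "'x set" and K :: "'x set set" and enc :: "'x set \<Rightarrow> 'u"
  assumes K_subset: "A \<in> K \<Longrightarrow> A \<subseteq> X"
    and K_space: "X \<in> K"
    and K_Diff: "A \<in> K \<Longrightarrow> X - A \<in> K"
    and K_Int: "\<lbrakk>A \<in> K; B \<in> K\<rbrakk> \<Longrightarrow> A \<inter> B \<in> K"
    and separated: "\<lbrakk>x \<in> X; y \<in> X; x \<noteq> y\<rbrakk> \<Longrightarrow> \<exists>A\<in>K. x \<in> A \<and> y \<notin> A"
    and K_compact: "\<lbrakk>\<C> \<subseteq> K; \<Union>\<C> = X\<rbrakk> \<Longrightarrow> \<exists>\<T>\<subseteq>\<C>. finite \<T> \<and> \<Union>\<T> = X"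
    and inj_enc: "inj_on enc (Pow X)"
begin

definition dec :: "'u \<Rightarrow> 'x set" where
  "dec = the_inv_into (Pow X) enc"

text \<open>The interior for the topology with base \<open>K\<close>; its fixed points are the open
  sets.\<close>

definition interior :: "'x set \<Rightarrow> 'x set" where
  "interior V = \<Union>{A \<in> K. A \<subseteq> V}"

definition alg :: "'u mt" where
  "alg = \<lparr>carrier = enc ` Pow X, eq = (=), le = (\<lambda>u v. dec u \<subseteq> dec v),
     box = (\<lambda>u. enc (interior (dec u)))\<rparr>"

lemma dec_enc [simp]: "V \<subseteq> X \<Longrightarrow> dec (enc V) = V"
  unfolding dec_def using inj_enc by (intro the_inv_into_f_f) auto

lemma carrier_alg: "carrier alg = enc ` Pow X"
  by (simp add: alg_def)

lemma enc_carrier [simp]: "V \<subseteq> X \<Longrightarrow> enc V \<in> carrier alg"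
  by (simp add: carrier_alg)

lemma box_enc [simp]: "V \<subseteq> X \<Longrightarrow> box alg (enc V) = enc (interior V)"
  by (simp add: alg_def)

lemma interior_subset: "interior V \<subseteq> V"
  by (auto simp: interior_def)

lemma interior_subset_space: "interior V \<subseteq> X"
  using K_subset by (auto simp: interior_def)

lemma interior_K: "A \<in> K \<Longrightarrow> interior A = A"
  by (auto simp: interior_def)

lemma interior_Int: "interior (V \<inter> W) = interior V \<inter> interior W"
proof
  show "interior V \<inter> interior W \<subseteq> interior (V \<inter> W)"
  proof
    fix x assume "x \<in> interior V \<inter> interior W"
    then obtain A B where "A \<in> K" "B \<in> K" "x \<in> A \<inter> B" "A \<subseteq> V" "B \<subseteq> W"
      by (auto simp: interior_def)
    thus "x \<in> interior (V \<inter> W)" using K_Int[of A B] by (auto simp: interior_def)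
  qed
qed (auto simp: interior_def)

lemma interior_interior: "interior (interior V) = interior V"
  unfolding interior_def by blast

sublocale alg: power_repr alg dec X
proof
  show "bij_betw dec (carrier alg) (Pow X)"
    unfolding dec_def carrier_alg
    using inj_enc by (intro bij_betw_the_inv_into inj_on_imp_bij_betw)
qed (simp_all add: alg_def)

lemma enc_dec: "u \<in> carrier alg \<Longrightarrow> enc (dec u) = u"
  by (auto simp: carrier_alg)

lemma alg_eq_iff: "\<lbrakk>u \<in> carrier alg; v \<in> carrier alg\<rbrakk> \<Longrightarrow> u = v \<longleftrightarrow> dec u = dec v"
  using alg.repr_eqD by blast

lemma box_alg_closed: "u \<in> carrier alg \<Longrightarrow> box alg u \<in> carrier alg"
  by (simp add: alg_def interior_subset_space)

lemma dec_box: "u \<in> carrier alg \<Longrightarrow> dec (box alg u) = interior (dec u)"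
  by (simp add: alg_def interior_subset_space)

lemma mt_algebra_alg: "mt_algebra alg"
proof unfold_locales
  show "box alg \<top>\<^bsub>alg\<^esub> = \<top>\<^bsub>alg\<^esub>"
    by (simp add: alg_eq_iff box_alg_closed dec_box alg.repr_top interior_K K_space)
next
  fix a b assume "a \<in> carrier alg" "b \<in> carrier alg"
  thus "box alg (a \<sqinter>\<^bsub>alg\<^esub> b) = box alg a \<sqinter>\<^bsub>alg\<^esub> box alg b"
    by (simp add: alg_eq_iff box_alg_closed dec_box alg.repr_meet interior_Int)
qed (simp_all add: box_alg_closed alg.le_repr dec_box interior_subset interior_interior)

sublocale mt: mt_algebra alg by (rule mt_algebra_alg)

lemma opens_alg: "opens alg = {u \<in> carrier alg. interior (dec u) = dec u}"
  by (auto simp: opens_def alg_eq_iff box_alg_closed dec_box)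

text \<open>A clopen set and its complement are both unions of members of \<open>K\<close>, which
  together cover \<open>X\<close>. In a finite subcover the members inside the set already cover it,
  and finite unions stay in \<open>K\<close>.\<close>

lemma clopens_alg: "clopens alg = enc ` K"
proof
  show "enc ` K \<subseteq> clopens alg"
    using K_subset by (auto simp: mt.clopens_eq opens_alg interior_K alg.repr_compl K_Diff)
  show "clopens alg \<subseteq> enc ` K"
  proof
    fix u assume "u \<in> clopens alg"
    hence u: "u \<in> carrier alg" "interior (dec u) = dec u" "interior (X - dec u) = X - dec u"
      by (auto simp: mt.clopens_eq opens_alg alg.repr_compl)
    have duX: "dec u \<subseteq> X" using u(1) by (rule alg.repr_subset)
    let ?C = "{A \<in> K. A \<subseteq> dec u} \<union> {A \<in> K. A \<subseteq> X - dec u}"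
    have "\<Union>?C = X" using u(2,3) duX unfolding interior_def by blast
    then obtain T where T: "T \<subseteq> ?C" "finite T" "\<Union>T = X"
      using K_compact[of ?C] by blast
    have fin: "\<Union>S \<in> K" if "finite S" "S \<subseteq> K" for S
      using that
    proof (induction S rule: finite_induct)
      case empty
      show ?case using K_Diff[OF K_space] by simp
    next
      case (insert A S)
      hence "X - ((X - A) \<inter> (X - \<Union>S)) \<in> K" by (intro K_Diff K_Int) auto
      moreover have "X - ((X - A) \<inter> (X - \<Union>S)) = A \<union> \<Union>S"
        using insert.prems K_subset by blast
      ultimately show ?case by simp
    qed
    have "\<Union>{A \<in> T. A \<subseteq> dec u} \<in> K"
      using T by (intro fin) auto
    moreover have "\<Union>{A \<in> T. A \<subseteq> dec u} = dec u"
      using T(1,3) duX by blast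
    ultimately have "dec u \<in> K" by simp
    thus "u \<in> enc ` K" using enc_dec[OF u(1)] by (metis imageI)
  qed
qed

text \<open>By \<open>separated\<close>, every point other than \<open>x\<close> has a neighbourhood
  in \<open>K\<close> that avoids \<open>x\<close>, so the complement of the singleton is open. For
  \<open>AC\<close>, every other point is excluded by a member of \<open>K\<close> around
  \<open>x\<close>, which is its own interior and closure.\<close>

lemma points_closed: "x \<in> X \<Longrightarrow> enc {x} \<in> closeds alg"
  and points_AC: "x \<in> X \<Longrightarrow> enc {x} \<in> AC alg"
proof -
  assume x: "x \<in> X"
  have "interior (X - {x}) = X - {x}"
  proof
    show "X - {x} \<subseteq> interior (X - {x})"
    proof
      fix y assume "y \<in> X - {x}"
      then obtain A where A: "A \<in> K" "y \<in> A" "x \<notin> A" using separated[of y x] x by auto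
      hence "A \<subseteq> X - {x}" using K_subset[OF A(1)] by auto
      thus "y \<in> interior (X - {x})" using A unfolding interior_def by auto
    qed
  qed (rule interior_subset)
  thus "enc {x} \<in> closeds alg"
    using x by (simp add: mt.closed_iff_compl_open opens_alg alg.repr_compl)
  let ?D = "{dia alg (box alg c) |c. c \<in> carrier alg \<and> enc {x} \<sqsubseteq>\<^bsub>alg\<^esub> box alg c}"
  have dia: "dia alg c \<in> carrier alg" "dec (dia alg c) = X - interior (X - dec c)"
    if "c \<in> carrier alg" for c
    using that by (simp_all add: dia_def alg.repr_compl box_alg_closed dec_box)
  have D: "?D \<subseteq> carrier alg" using dia(1) box_alg_closed by blast
  have "dec (\<Sqinter>\<^bsub>alg\<^esub>?D) = {x}"
    unfolding alg.repr_inf[OF D]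
  proof (intro equalityI subsetI)
    fix y assume y: "y \<in> X \<inter> \<Inter> (dec ` ?D)"
    show "y \<in> {x}"
    proof (rule ccontr)
      assume "y \<notin> {x}"
      then obtain A where A: "A \<in> K" "x \<in> A" "y \<notin> A" using separated[OF x, of y] y by blast
      have AX: "A \<subseteq> X" using K_subset A(1) .
      have "enc {x} \<sqsubseteq>\<^bsub>alg\<^esub> box alg (enc A)"
        using A x AX by (simp add: interior_K alg.le_repr)
      hence "dia alg (box alg (enc A)) \<in> ?D" using enc_carrier[OF AX] by (intro CollectI exI[of _ "enc A"] conjI) simp_all
      hence "y \<in> dec (dia alg (box alg (enc A)))" using y by blast
      thus False
        using A AX by (simp add: interior_K dia(2) K_Diff)
    qed
  next
    fix y assume y: "y \<in> {x}"
    have "x \<in> dec (dia alg (box alg c))" if c: "c \<in> carrier alg" "enc {x} \<sqsubseteq>\<^bsub>alg\<^esub> box alg c" for c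
    proof -
      have "x \<in> dec (box alg c)" using c x by (simp add: alg.le_repr box_alg_closed)
      thus ?thesis
        using x interior_subset[of "X - dec (box alg c)"] c(1) by (auto simp: dia(2) box_alg_closed)
    qed
    thus "y \<in> X \<inter> \<Inter> (dec ` ?D)" using x y by blast
  qed
  hence "enc {x} = \<Sqinter>\<^bsub>alg\<^esub>?D" using x D by (simp add: alg_eq_iff)
  thus "enc {x} \<in> AC alg" using x unfolding AC_def by simp
qed

text \<open>Singletons are closed and belong to \<open>AC alg\<close>, so this one decomposition
  witnesses both T1 and Hausdorff.\<close>

lemma eq_sup_points:
  assumes "a \<in> carrier alg"
  shows "a = \<Squnion>\<^bsub>alg\<^esub>((\<lambda>x. enc {x}) ` dec a)"
proof -
  have aX: "dec a \<subseteq> X" using assms by (rule alg.repr_subset)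
  hence c: "(\<lambda>x. enc {x}) ` dec a \<subseteq> carrier alg" by auto
  have "(\<Union>x\<in>dec a. dec (enc {x})) = (\<Union>x\<in>dec a. {x})"
    using aX by (intro SUP_cong HOL.refl dec_enc) auto
  hence "(\<Union>x\<in>dec a. dec (enc {x})) = dec a" by simp
  thus ?thesis using assms c by (simp add: alg_eq_iff alg.repr_sup image_image)
qed

lemma stone_alg: "stone_mt alg"
proof -
  have "T1 alg"
    unfolding T1_def
  proof
    fix a assume a: "a \<in> carrier alg"
    have "(\<lambda>x. enc {x}) ` dec a \<subseteq> closeds alg"
      using points_closed alg.repr_subset[OF a] by blast
    thus "\<exists>S\<subseteq>closeds alg. a = \<Squnion>\<^bsub>alg\<^esub>S" using eq_sup_points[OF a] by blast
  qed
  moreover have "hausdorff_mt alg"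
    unfolding hausdorff_mt_def
  proof
    fix a assume a: "a \<in> carrier alg"
    have "(\<lambda>x. enc {x}) ` dec a \<subseteq> AC alg"
      using points_AC alg.repr_subset[OF a] by blast
    thus "\<exists>S\<subseteq>AC alg. a = \<Squnion>\<^bsub>alg\<^esub>S" using eq_sup_points[OF a] by blast
  qed
  moreover have "a = \<Squnion>\<^bsub>alg\<^esub>{b \<in> clopens alg. b \<sqsubseteq>\<^bsub>alg\<^esub> a}" if a: "a \<in> opens alg" for a
  proof -
    have aM: "a \<in> carrier alg" and i: "interior (dec a) = dec a"
      using a by (auto simp: opens_alg)
    let ?B = "{b \<in> clopens alg. b \<sqsubseteq>\<^bsub>alg\<^esub> a}"
    have B: "?B \<subseteq> carrier alg" using mt.clopens_carrier by blast
    have "?B = enc ` {A \<in> K. A \<subseteq> dec a}"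
      using K_subset aM by (auto simp: clopens_alg alg.le_repr)
    hence "\<Union>(dec ` ?B) = \<Union>{A \<in> K. A \<subseteq> dec a}"
      using K_subset by (auto simp: image_image)
    thus ?thesis using B aM i by (simp add: alg_eq_iff alg.repr_sup interior_def)
  qed
  moreover have "compact_mt alg"
    unfolding compact_mt_def
  proof (intro allI impI)
    fix S assume S: "S \<subseteq> opens alg" and top: "\<Squnion>\<^bsub>alg\<^esub>S = \<top>\<^bsub>alg\<^esub>"
    have Sc: "S \<subseteq> carrier alg" using S mt.opens_carrier by (rule subset_trans)
    have "\<Union>(dec ` S) = X" using top alg.repr_sup[OF Sc] alg.repr_top by simp
    have int: "dec s = \<Union>{A \<in> K. A \<subseteq> dec s}" if "s \<in> S" for s
      using S that by (auto simp: opens_alg interior_def)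
    \<comment> \<open>\<open>K_compact\<close> speaks of covers by members of \<open>K\<close> only,
      so the open cover is refined to such a cover; afterwards one member of \<open>S\<close> is
      chosen around each of the finitely many sets.\<close>
    let ?C = "{A \<in> K. \<exists>s\<in>S. A \<subseteq> dec s}"
    have "\<Union>?C = (\<Union>s\<in>S. \<Union>{A \<in> K. A \<subseteq> dec s})" by blast
    also have "\<dots> = X" using int \<open>\<Union>(dec ` S) = X\<close> by simp
    finally obtain T where T: "T \<subseteq> ?C" "finite T" "\<Union>T = X"
      using K_compact[of ?C] by blast
    have "\<forall>A\<in>T. \<exists>s\<in>S. A \<subseteq> dec s" using T(1) by blast
    then obtain s where s: "\<forall>A\<in>T. s A \<in> S \<and> A \<subseteq> dec (s A)" by metis
    have sT: "s ` T \<subseteq> S" "finite (s ` T)" using s T(2) by auto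
    have sc: "s ` T \<subseteq> carrier alg" using sT(1) Sc by (rule subset_trans)
    have "\<Union>(dec ` s ` T) = X"
    proof
      show "\<Union>(dec ` s ` T) \<subseteq> X" using sc alg.repr_subset by (intro UN_least) auto
      show "X \<subseteq> \<Union>(dec ` s ` T)" using T(3) s by (intro order.trans[OF equalityD2[OF T(3)]] Union_least) auto
    qed
    hence "\<Squnion>\<^bsub>alg\<^esub>(s ` T) = \<top>\<^bsub>alg\<^esub>" using sc by (simp add: alg_eq_iff alg.repr_sup alg.repr_top)
    thus "\<exists>T\<subseteq>S. finite T \<and> \<Squnion>\<^bsub>alg\<^esub>T = \<top>\<^bsub>alg\<^esub>" using sT by blast
  qed
  ultimately show ?thesis
    using mt_algebra_alg by (simp add: stone_mt_def zero_dim_def)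
qed

text \<open>Places the clopen algebra on the points \<open>X\<close>. With ultrafilters as points,
  it can be compared with the original boolean algebra over the same set.\<close>

lemma clp_alg_set_repr: "set_repr (clp_algebra alg) dec X"
proof (unfold_locales, unfold mt.carrier_clp mt.le_clp)
  show "inj_on dec (clopens alg)"
    using alg.inj_repr mt.clopens_carrier by (rule inj_on_subset)
next
  fix x y assume "x \<in> clopens alg" "y \<in> clopens alg"
  thus "\<exists>z\<in>clopens alg. dec z = dec x \<inter> dec y"
    by (intro bexI[of _ "x \<sqinter>\<^bsub>alg\<^esub> y"]) (simp_all add: alg.repr_meet mt.clopenD mt.clopens_meet)
next
  fix x assume "x \<in> clopens alg"
  thus "\<exists>z\<in>clopens alg. dec z = X - dec x"
    by (intro bexI[of _ "compl alg x"]) (simp_all add: alg.repr_compl mt.clopenD mt.clopens_compl)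
next
  show "\<exists>z\<in>clopens alg. dec z = X"
    by (intro bexI[of _ "\<top>\<^bsub>alg\<^esub>"]) (simp_all add: alg.repr_top mt.clopens_top)
qed (simp_all add: clp_algebra_def mt.clopenD alg.le_repr alg.repr_subset)

end

section \<open>The ultrafilter space and essential surjectivity\<close>

lemma (in boolean_lattice) stone_space_ultrafilters:
  assumes "inj_on enc (Pow (ultrafilters L))"
  shows "stone_space (ultrafilters L) ((\<lambda>x. {U \<in> ultrafilters L. x \<in> U}) ` carrier L) enc"
proof -
  let ?s = "\<lambda>x. {U \<in> ultrafilters L. x \<in> U}"
  interpret S: set_repr L ?s "ultrafilters L" by (rule ultrafilter_set_repr)
  show ?thesis
  proof
    show "\<exists>A\<in>?s ` carrier L. U \<in> A \<and> V \<notin> A"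
      if UV: "U \<in> ultrafilters L" "V \<in> ultrafilters L" "U \<noteq> V" for U V
    proof -
      \<comment> \<open>Ultrafilters are maximal: if \<open>U \<subseteq> V\<close> and
        \<open>x\<close> is in \<open>V\<close> but not in \<open>U\<close>, then
        \<open>compl L x\<close> is in \<open>U\<close>, hence in \<open>V\<close> together with
        \<open>x\<close>.\<close>
      have "\<exists>x\<in>carrier L. x \<in> U \<and> x \<notin> V"
      proof (rule ccontr)
        assume no: "\<not> ?thesis"
        have "U \<subseteq> V" using no ultrafilter_subset[OF UV(1)] by blast
        moreover have "V \<subseteq> U"
        proof
          fix x assume x: "x \<in> V"
          hence "x \<in> carrier L" using ultrafilter_subset[OF UV(2)] by blast
          thus "x \<in> U"
            using x no ultrafilter_compl[OF UV(1), of x] ultrafilter_compl[OF UV(2), of x] compl_closed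
            by metis
        qed
        ultimately show False using UV(3) by blast
      qed
      then obtain x where "x \<in> carrier L" "x \<in> U" "x \<notin> V" by (elim bexE conjE)
      thus ?thesis using UV(1) by (intro bexI[of _ "?s x"]) simp_all
    qed
    show "\<exists>\<T>\<subseteq>\<C>. finite \<T> \<and> \<Union>\<T> = ultrafilters L"
      if C: "\<C> \<subseteq> ?s ` carrier L" and cover: "\<Union>\<C> = ultrafilters L" for \<C>
    proof -
      \<comment> \<open>The cover is named by a set \<open>S\<close> of elements. That it covers
        means that every ultrafilter meets \<open>S\<close>, the form in which
        \<open>ultrafilters_compact\<close> applies.\<close>
      obtain S where S: "S \<subseteq> carrier L" "\<C> = ?s ` S" using C by (auto simp: subset_image_iff)
      have "S \<inter> U \<noteq> {}" if "U \<in> ultrafilters L" for U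
        using cover that unfolding S(2) by blast
      then obtain T where T: "T \<subseteq> S" "finite T" "\<forall>U\<in>ultrafilters L. T \<inter> U \<noteq> {}"
        using ultrafilters_compact[OF S(1)] by blast
      have "\<Union>(?s ` T) = ultrafilters L" using T(3) by blast
      thus ?thesis using T(1,2) S(2) by (intro exI[of _ "?s ` T"]) blast
    qed
  next
    fix A B assume "A \<in> ?s ` carrier L" "B \<in> ?s ` carrier L"
    then obtain x y where "x \<in> carrier L" "y \<in> carrier L" "A = ?s x" "B = ?s y"
      by (elim imageE)
    thus "A \<inter> B \<in> ?s ` carrier L" using S.repr_meet[of x y] by (intro image_eqI[of _ _ "x \<sqinter> y"]) simp_all
  next
    fix A assume "A \<in> ?s ` carrier L"
    then obtain x where "x \<in> carrier L" "A = ?s x" by (elim imageE)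
    thus "ultrafilters L - A \<in> ?s ` carrier L"
      using S.repr_compl[of x] by (intro image_eqI[of _ _ "compl L x"]) simp_all
  next
    show "ultrafilters L \<in> ?s ` carrier L"
      using S.repr_top by (intro image_eqI[of _ _ "\<top>"]) simp_all
  qed (use assms in auto)
qed

lemma clp_ess_surj:
  fixes A :: "'u gorder"
  assumes small: "smallness small" and A: "A \<in> Obj (BA small)"
  shows "\<exists>M\<in>Obj (StoneMT small). \<exists>f. is_iso (BA small) (clp_algebra M) A f"
proof -
  have "boolean_lattice A" and sm: "small (carrier A)" using A by (simp_all add: BA_def)
  then interpret A: boolean_lattice A by simp
  let ?X = "ultrafilters A" and ?s = "\<lambda>x. {U \<in> ultrafilters A. x \<in> U}"
  \<comment> \<open>Ultrafilters are subsets of the carrier, so sets of them need two power sets of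
    room, which \<open>smallness\<close> provides.\<close>
  have "?X \<subseteq> Pow (carrier A)" using A.ultrafilter_subset by blast
  hence "Pow ?X \<lesssim> Pow (Pow (carrier A))" by (intro subset_imp_lepoll Pow_mono)
  also have "\<dots> \<lesssim> (UNIV :: 'u set)" using small sm by (simp add: smallness_def)
  finally obtain enc :: "'u set set \<Rightarrow> 'u" where "inj_on enc (Pow ?X)" by (auto simp: lepoll_def)
  then interpret S: stone_space ?X "?s ` carrier A" enc by (rule A.stone_space_ultrafilters)
  let ?M = "S.alg"
  interpret s: set_repr A ?s ?X by (rule A.ultrafilter_set_repr)
  have clopens: "clopens ?M = (\<lambda>x. enc (?s x)) ` carrier A"
    by (simp add: S.clopens_alg image_image)
  have dec: "S.dec (enc (?s x)) = ?s x" for x by (rule S.dec_enc) blast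
  define g where "g = (\<lambda>x\<in>carrier A. enc (?s x))"
  define f where "f = (\<lambda>u\<in>clopens ?M. inv_into (carrier A) (\<lambda>x. enc (?s x)) u)"
  have inj: "inj_on (\<lambda>x. enc (?s x)) (carrier A)"
  proof (rule inj_onI)
    fix x y assume "x \<in> carrier A" "y \<in> carrier A" "enc (?s x) = enc (?s y)"
    moreover from this have "?s x = ?s y" using arg_cong[of _ _ S.dec] dec by metis
    ultimately show "x = y" by (intro s.repr_eqD)
  qed
  have fg: "f (g x) = x" if "x \<in> carrier A" for x
    using that inv_into_f_f[OF inj that] by (simp add: f_def g_def clopens)
  have gf: "g (f u) = u" if "u \<in> clopens ?M" for u
    using that fg by (auto simp: g_def clopens)
  have g_ext: "g \<in> carrier A \<rightarrow>\<^sub>E clopens ?M" by (auto simp: g_def clopens)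
  have f_ext: "f \<in> clopens ?M \<rightarrow>\<^sub>E carrier A" using inv_into_f_f[OF inj] by (auto simp: f_def clopens)
  \<comment> \<open>\<open>A\<close> and the clopen algebra have the same points, and both
    \<open>g\<close> and \<open>f\<close> keep the represented set of ultrafilters; they are
    preimage maps of the identity.\<close>
  have "g \<in> BA_hom A (clp_algebra ?M)"
    by (rule preimage_BA_hom[OF s.set_repr_axioms S.clp_alg_set_repr, where p = "\<lambda>x. x"])
      (use g_ext dec in \<open>simp_all add: g_def\<close>)
  moreover have "f \<in> BA_hom (clp_algebra ?M) A"
  proof (rule preimage_BA_hom[OF S.clp_alg_set_repr s.set_repr_axioms, where p = "\<lambda>x. x"])
    fix u assume "u \<in> carrier (clp_algebra ?M)"
    hence "u \<in> clopens ?M" by simp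
    hence "enc (?s (f u)) = u" using gf[of u] PiE_mem[OF f_ext, of u] by (simp add: g_def)
    hence "S.dec u = ?s (f u)" using dec[of "f u"] by simp
    thus "?s (f u) = {y \<in> ?X. y \<in> S.dec u}" by blast
  qed (use f_ext in simp_all)
  moreover have "compose (clopens ?M) g f = (\<lambda>u\<in>clopens ?M. u)"
    "compose (carrier A) f g = (\<lambda>x\<in>carrier A. x)"
    using fg gf by (auto simp: compose_def fun_eq_iff)
  ultimately have "is_iso (BA small) (clp_algebra ?M) A f"
    by (auto simp: is_iso_def BA_def)
  \<comment> \<open>The size of an object of \<open>StoneMT\<close> is read off its clopens, and
    these are in bijection with the small carrier of \<open>A\<close>.\<close>
  moreover have "carrier A \<approx> clopens ?M"
    unfolding clopens eqpoll_def using inj by (blast intro: inj_on_imp_bij_betw)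
  hence "small (clopens ?M)" using small sm unfolding smallness_def by blast
  hence "?M \<in> Obj (StoneMT small)" using S.stone_alg by (simp add: StoneMT_def)
  ultimately show ?thesis by blast
qed

theorem theorem7p16:
  fixes small :: "'u set \<Rightarrow> bool"
  assumes "smallness small"
  shows "is_equivalence (StoneMT small) (BA small) clp"
proof (rule is_equivalenceI)
  show "bij_betw (mmap clp M N) (Hom (StoneMT small) M N) (Hom (BA small) (omap clp M) (omap clp N))"
    if "M \<in> Obj (StoneMT small)" "N \<in> Obj (StoneMT small)" for M N
  proof -
    have M: "stone_mt M" "mt_algebra M" and N: "stone_mt N" "mt_algebra N"
      using that by (simp_all add: StoneMT_def stone_mt_def)
    have "bij_betw (\<lambda>f. restrict f (clopens M)) (MT_hom M N)
        (BA_hom (clp_algebra M) (clp_algebra N))"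
      unfolding bij_betw_def
    proof (intro conjI inj_onI)
      show "(\<lambda>f. restrict f (clopens M)) ` MT_hom M N = BA_hom (clp_algebra M) (clp_algebra N)"
        using clp_BA_hom[OF M(2) N(2)] clp_full[OF M(1) N(1)] by blast
    qed (rule clp_faithful[OF M(1) N(2)])
    thus ?thesis by (simp add: clp_def StoneMT_def BA_def)
  qed
  show "\<exists>M\<in>Obj (StoneMT small). \<exists>f. is_iso (BA small) (omap clp M) A f"
    if "A \<in> Obj (BA small)" for A
    using clp_ess_surj[OF assms that] by (simp add: clp_def)
qed (rule is_category_StoneMT is_category_BA is_functor_clp)+

end
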